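(* For every real $0\le\eta<0.5$ there exists a constant $\gamma=\gamma(\eta)>0$ such that for every positive integer $n$ and every real $0<\epsilon<1$ there exists a polynomial $p=p_{n,\eta,\epsilon}$ in the entries of a $2n\times 2n$ complex symmetric matrix $A=(a_{ij})$ such that $\deg p\le\gamma(\ln n-\ln\epsilon)$ and $$\left|\ln\operatorname{haf}A-p(A)\right|\le\epsilon$$ for all $2n\times 2n$ complex symmetric matrices $A=(a_{ij})$ satisfying $|1-a_{ij}|\le\eta$ for all $i,j$.
   Context: The hafnian of a $2n\times 2n$ symmetric matrix $A=(a_{ij})$ is $\operatorname{haf}A=\sum a_{i_1j_1}\cdots a_{i_nj_n}$, where the sum is over all $(2n)!/(2^n n!)$ unordered partitions of $\{1,\dots,2n\}$ into $n$ pairwise disjoint unordered pairs $\{i_1,j_1\},\dots,\{i_n,j_n\}$. Branch of the logarithm: let $D$ be the convex set of all $2n\times 2n$ symmetric complex matrices $Z=(z_{ij})$ with $|1-z_{ij}|\le 0.5$ for all $i,j$. The hafnian has no zeros on $D$, and $\ln\operatorname{haf}$ denotes the continuous branch on $D$ (a continuous function $L$ with $e^{L(Z)}=\operatorname{haf}Z$) which is real at real matrices; in particular its value at the all-ones matrix is the real number $\ln\frac{(2n)!}{2^n n!}$. *)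

theory Defs
  imports
    "Jordan_Normal_Form.Matrix"
    "HOL-Analysis.Function_Topology"
    "HOL-Library.Poly_Mapping"
    "HOL-Library.Disjoint_Sets"
begin

text \<open>Matrix indices start at 0, so the index set \<open>{1,\<dots>,2n}\<close> becomes \<open>{..<2*n}\<close>.\<close>

definition pair_partitions :: "'a set \<Rightarrow> 'a set set set" where
  "pair_partitions S = {M. partition_on S M \<and> (\<forall>e\<in>M. card e = 2)}"

text \<open>The unordered pair \<open>{i, j}\<close> contributes the entry with \<open>i < j\<close>; for symmetric \<open>A\<close>,
  the only case of interest, the order does not matter.\<close>

definition haf :: "'a::comm_ring_1 mat \<Rightarrow> 'a" where
  "haf A = (\<Sum>M\<in>pair_partitions {..<dim_row A}. \<Prod>e\<in>M. A $$ (Min e, Max e))"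

definition sym_near_ones :: "nat \<Rightarrow> real \<Rightarrow> complex mat set" where
  "sym_near_ones n r = {A \<in> carrier_mat (2 * n) (2 * n). transpose_mat A = A \<and>
     (\<forall>i<2 * n. \<forall>j<2 * n. norm (1 - A $$ (i, j)) \<le> r)}"

text \<open>The type of matrices carries no topology in the library. Continuity of \<open>L\<close> is continuity as
  a function of the matrix entries: \<open>mat (2 * n) (2 * n)\<close> only reads the finitely many values
  of \<open>a\<close> at indices below \<open>2 * n\<close>, so in the product topology this is
  continuity in the usual topology on the space of matrices.\<close>

definition is_ln_haf_branch :: "nat \<Rightarrow> (complex mat \<Rightarrow> complex) \<Rightarrow> bool" where
  "is_ln_haf_branch n L \<longleftrightarrow>
     continuous_on {a. mat (2 * n) (2 * n) a \<in> sym_near_ones n (1/2)} (\<lambda>a. L (mat (2 * n) (2 * n) a)) \<and>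
     (\<forall>A\<in>sym_near_ones n (1/2). exp (L A) = haf A) \<and>
     (\<forall>A\<in>sym_near_ones n (1/2). (\<forall>i<2 * n. \<forall>j<2 * n. A $$ (i, j) \<in> \<real>) \<longrightarrow> L A \<in> \<real>)"

text \<open>A branch exists because the hafnian has no zeros on the convex set \<open>sym_near_ones n (1/2)\<close>,
  and any two branches agree on that set (though not outside it, where the value is unspecified).\<close>

definition ln_haf :: "nat \<Rightarrow> complex mat \<Rightarrow> complex" where
  "ln_haf n = (SOME L. is_ln_haf_branch n L)"

text \<open>Multivariate polynomials as finitely supported maps from monomials to coefficients,
  a monomial being a finitely supported map from variables to exponents.\<close>

type_synonym ('v, 'a) mpolynomial = "('v \<Rightarrow>\<^sub>0 nat) \<Rightarrow>\<^sub>0 'a"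

definition mp_vars :: "('v, 'a::zero) mpolynomial \<Rightarrow> 'v set" where
  "mp_vars p = (\<Union>m\<in>Poly_Mapping.keys p. Poly_Mapping.keys m)"

text \<open>The zero polynomial gets degree 0.\<close>

definition mp_degree :: "('v, 'a::zero) mpolynomial \<Rightarrow> nat" where
  "mp_degree p = Max (insert 0 ((\<lambda>m. \<Sum>v\<in>Poly_Mapping.keys m. Poly_Mapping.lookup m v) ` Poly_Mapping.keys p))"

definition mp_eval :: "('v, 'a::comm_semiring_1) mpolynomial \<Rightarrow> ('v \<Rightarrow> 'a) \<Rightarrow> 'a" where
  "mp_eval p x = (\<Sum>m\<in>Poly_Mapping.keys p. Poly_Mapping.lookup p m *
     (\<Prod>v\<in>Poly_Mapping.keys m. x v ^ Poly_Mapping.lookup m v))"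

end

theory Submission
  imports Defs
    "HOL-Analysis.Complex_Transcendental"
    "HOL-Computational_Algebra.Fundamental_Theorem_Algebra"
    "HOL-Computational_Algebra.Polynomial_FPS"
begin

text \<open>Let \<open>J\<close> be the all-ones matrix and restrict the hafnian to the complex line through \<open>J\<close> and \<open>A\<close>:
  \<open>g z = haf (J + z (A - J))\<close> is a polynomial of degree at most \<open>n\<close> in \<open>z\<close>. If the entries of \<open>A\<close> are within
  \<open>\<eta> < 1/2\<close> of \<open>1\<close>, the hafnian has no zeros on the part of the line with \<open>2 * \<eta> * norm z \<le> 1\<close>, a disc of
  radius larger than one. So \<open>ln g\<close> is a sum of at most \<open>n\<close> terms \<open>ln (1 - r z)\<close> with \<open>norm r \<le> 2 * \<eta>\<close>,
  plus a constant, and its Taylor polynomial of order \<open>m\<close> approximates it at \<open>z = 1\<close> with an error that is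
  exponentially small in \<open>m\<close> and linear in \<open>n\<close> (lemma \<open>ln_haf_taylor_error\<close>). Thus an order
  proportional to \<open>ln n - ln \<epsilon>\<close> suffices.

  By Newton's identities the Taylor coefficients of \<open>ln g\<close> are polynomials in the coefficients of \<open>g\<close>.
  Since the coefficient of \<open>z ^ k\<close> in \<open>g\<close> has degree at most \<open>k\<close> in the entries of \<open>A\<close>, and \<open>g 0 = haf J\<close>
  does not depend on \<open>A\<close>, the Taylor polynomial of order \<open>m\<close> at \<open>z = 1\<close> is a polynomial of degree at most
  \<open>m\<close> in the entries (lemma \<open>poly_fun_log_taylor\<close>).

  The absence of zeros is proved by induction on the number of vertices together with a statement on angles:
  changing one row and column within the domain turns the value of the hafnian by at most a right angle
  (lemma \<open>matching_sum_zero_free_aux\<close>). The step rests on a fact of plane geometry about combinations, with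
  coefficients within \<open>1/2\<close> of \<open>1\<close>, of numbers that pairwise enclose at most a right angle (lemma
  \<open>combinations_nonzero_and_right_angle\<close>). The statement on angles also provides the branch
  of the logarithm: changing the rows of \<open>J\<close> into those of \<open>A\<close> one after another multiplies the hafnian by
  factors on which the principal logarithm is continuous (\<open>row_by_row_log\<close>).\<close>

section \<open>Hafnians as sums over the perfect matchings of a vertex set\<close>

text \<open>Weights live on the edges \<open>e\<close> themselves rather than on index pairs. Deleting vertices then
  leaves the weight function alone, renaming vertices becomes composition with an image map, and
  polynomials in one variable can serve as weights as well as numbers.\<close>

definition matching_sum :: "'a set \<Rightarrow> ('a set \<Rightarrow> 'b::comm_semiring_1) \<Rightarrow> 'b" where
  "matching_sum S w = (\<Sum>M\<in>pair_partitions S. \<Prod>e\<in>M. w e)"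

lemma finite_pair_partitions: "finite S \<Longrightarrow> finite (pair_partitions S)"
  using finitely_many_partition_on[of S] unfolding pair_partitions_def
  by (rule rev_finite_subset) auto

lemma pair_partitions_edge:
  assumes "M \<in> pair_partitions S" "e \<in> M"
  shows "e \<subseteq> S" "card e = 2"
  using assms by (auto simp: pair_partitions_def partition_on_def)

lemma finite_matching: "finite S \<Longrightarrow> M \<in> pair_partitions S \<Longrightarrow> finite M"
  by (auto simp: pair_partitions_def intro: finite_elements)

lemma card_matching:
  assumes "M \<in> pair_partitions S"
  shows "card S = 2 * card M"
proof -
  have "card S = (\<Sum>e\<in>M. card e)"
    using assms by (intro product_partition) (auto simp: pair_partitions_def intro: card_ge_0_finite)
  also have "\<dots> = (\<Sum>e\<in>M. 2)"
    using assms by (intro sum.cong) (auto simp: pair_partitions_def)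
  finally show ?thesis by simp
qed

lemma matching_sum_cong:
  assumes "\<And>e. e \<subseteq> S \<Longrightarrow> card e = 2 \<Longrightarrow> w e = w' e"
  shows "matching_sum S w = matching_sum S w'"
  unfolding matching_sum_def
  by (intro sum.cong prod.cong refl assms) (auto dest: pair_partitions_edge)

lemma matching_sum_empty: "matching_sum ({} :: 'a set) w = 1"
proof -
  have "pair_partitions {} = {{} :: 'a set set}"
    by (auto simp: pair_partitions_def partition_on_empty)
  thus ?thesis by (simp add: matching_sum_def)
qed

lemma pair_partitions_insert_edge:
  assumes "i \<in> S" "j \<in> S" "i \<noteq> j"
  shows "insert {i,j} M \<in> pair_partitions S \<and> {i,j} \<notin> M \<longleftrightarrow> M \<in> pair_partitions (S - {i,j})"
proof (cases "{i,j} \<inter> \<Union>M = {}")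
  case True
  hence "{i,j} \<notin> M" by auto
  with True assms show ?thesis
    by (simp add: pair_partitions_def partition_on_insert disjnt_def)
next
  case False
  then obtain e where e: "e \<in> M" "{i,j} \<inter> e \<noteq> {}" by auto
  have "M \<notin> pair_partitions (S - {i,j})"
    using e by (auto dest: pair_partitions_edge(1))
  moreover have "\<not> (insert {i,j} M \<in> pair_partitions S \<and> {i,j} \<notin> M)"
  proof
    assume *: "insert {i,j} M \<in> pair_partitions S \<and> {i,j} \<notin> M"
    hence "disjoint (insert {i,j} M)" by (auto simp: pair_partitions_def partition_on_def)
    hence "disjnt {i,j} e" using e * by (auto simp: pairwise_def)
    thus False using e by (auto simp: disjnt_def)
  qed
  ultimately show ?thesis by blast
qed

text \<open>Every perfect matching pairs \<open>i\<close> with exactly one other vertex \<open>j\<close>; this is the expansion of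
  the hafnian along a row.\<close>

lemma matching_sum_row:
  assumes "finite S" "i \<in> S"
  shows "matching_sum S w = (\<Sum>j\<in>S-{i}. w {i,j} * matching_sum (S - {i,j}) w)"
proof -
  define F where "F = (\<lambda>M. \<Prod>e\<in>M. w e)"
  have "(\<Sum>j\<in>S-{i}. w {i,j} * matching_sum (S - {i,j}) w)
      = (\<Sum>j\<in>S-{i}. \<Sum>M\<in>pair_partitions (S - {i,j}). F (insert {i,j} M))"
    unfolding matching_sum_def sum_distrib_left
  proof (intro sum.cong refl)
    fix j M assume j: "j \<in> S - {i}" and M: "M \<in> pair_partitions (S - {i,j})"
    have "{i,j} \<notin> M" using M by (auto dest: pair_partitions_edge(1))
    moreover have "finite M" using M assms by (auto intro: finite_matching)
    ultimately show "w {i,j} * prod w M = F (insert {i,j} M)" by (simp add: F_def)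
  qed
  also have "\<dots> = (\<Sum>(j,M)\<in>(SIGMA j:S-{i}. pair_partitions (S - {i,j})). F (insert {i,j} M))"
    using assms by (intro sum.Sigma) (auto intro: finite_pair_partitions)
  also have "\<dots> = (\<Sum>x\<in>(SIGMA j:S-{i}. pair_partitions (S - {i,j})). F (case x of (j,M) \<Rightarrow> insert {i,j} M))"
    by (intro sum.cong) auto
  also have "\<dots> = sum F (pair_partitions S)"
  proof (rule sum.reindex_bij_betw, rule bij_betwI')
    fix x y assume "x \<in> (SIGMA j:S-{i}. pair_partitions (S - {i,j}))"
      "y \<in> (SIGMA j:S-{i}. pair_partitions (S - {i,j}))"
    then obtain j M k N where xy: "x = (j,M)" "y = (k,N)"
      and M: "j \<in> S - {i}" "M \<in> pair_partitions (S - {i,j})"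
      and N: "k \<in> S - {i}" "N \<in> pair_partitions (S - {i,k})" by auto
    have iM: "i \<notin> e" if "e \<in> M" for e using that M by (auto dest: pair_partitions_edge(1))
    have iN: "i \<notin> e" if "e \<in> N" for e using that N by (auto dest: pair_partitions_edge(1))
    have "j = k \<and> M = N" if *: "insert {i,j} M = insert {i,k} N"
    proof -
      have "{i,j} \<in> insert {i,k} N" using * by blast
      hence "{i,j} = {i,k}" using iN by blast
      moreover have "{i,j} \<notin> M" "{i,k} \<notin> N"
        using iM iN by blast+
      ultimately show ?thesis using * by (metis doubleton_eq_iff insert_ident)
    qed
    thus "((case x of (j,M) \<Rightarrow> insert {i,j} M) = (case y of (j,M) \<Rightarrow> insert {i,j} M)) = (x = y)"
      using xy by auto
  next
    fix x assume "x \<in> (SIGMA j:S-{i}. pair_partitions (S - {i,j}))"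
    thus "(case x of (j,M) \<Rightarrow> insert {i,j} M) \<in> pair_partitions S"
      using assms pair_partitions_insert_edge by fastforce
  next
    fix N assume N: "N \<in> pair_partitions S"
    then obtain e where e: "e \<in> N" "i \<in> e"
      using assms by (auto simp: pair_partitions_def partition_on_def)
    have "card e = 2" "e \<subseteq> S" using N e by (auto dest: pair_partitions_edge)
    then obtain j where j: "e = {i,j}" "j \<noteq> i" "j \<in> S"
      using e by (auto simp: card_2_iff)
    have "N - {e} \<in> pair_partitions (S - {i,j})"
      using pair_partitions_insert_edge[of i S j "N - {e}"] j e N assms
      by (simp add: insert_absorb)
    thus "\<exists>x\<in>(SIGMA j:S-{i}. pair_partitions (S - {i,j})). N = (case x of (j,M) \<Rightarrow> insert {i,j} M)"
      using j e by (intro bexI[of _ "(j, N - {e})"]) auto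
  qed
  finally show ?thesis by (simp add: matching_sum_def F_def)
qed

lemma pair_partitions_image:
  assumes "M \<in> pair_partitions S" "inj_on f S"
  shows "image f ` M \<in> pair_partitions (f ` S)"
proof -
  have "{} \<notin> image f ` M" using assms by (auto simp: pair_partitions_def partition_on_def)
  hence "partition_on (f ` S) (image f ` M)"
    using partition_on_inj_image[of S M f] assms by (auto simp: pair_partitions_def)
  moreover have "card (f ` e) = 2" if "e \<in> M" for e
    using pair_partitions_edge[OF assms(1) that] assms(2) by (metis card_image inj_on_subset)
  ultimately show ?thesis by (auto simp: pair_partitions_def)
qed

lemma matching_sum_image:
  assumes "inj_on f S"
  shows "matching_sum (f ` S) w = matching_sum S (\<lambda>e. w (f ` e))"
proof -
  define g where "g = the_inv_into S f"
  have gf: "g (f x) = x" if "x \<in> S" for x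
    using assms that by (simp add: g_def the_inv_into_f_f)
  have g: "inj_on g (f ` S)" "g ` f ` S = S"
    using gf assms by (auto simp: inj_on_def image_iff)
  have gfe: "g ` f ` e = e" if "e \<subseteq> S" for e using that gf by force
  have fge: "f ` g ` e = e" if "e \<subseteq> f ` S" for e using that gf by force
  have gfM: "image g ` image f ` M = M" if "M \<in> pair_partitions S" for M
    using gfe pair_partitions_edge(1)[OF that] by (force simp: image_iff)
  have fgM: "image f ` image g ` M = M" if "M \<in> pair_partitions (f ` S)" for M
    using fge pair_partitions_edge(1)[OF that] by (force simp: image_iff)
  show ?thesis unfolding matching_sum_def
  proof (rule sum.reindex_bij_witness[where i = "image (image f)" and j = "image (image g)"])
    fix M assume M: "M \<in> pair_partitions (f ` S)"
    show "image f ` image g ` M = M" by (rule fgM[OF M])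
    show "image g ` M \<in> pair_partitions S" using pair_partitions_image[OF M g(1)] g(2) by simp
    have "inj_on (image g) M"
      by (rule inj_on_inverseI[of _ "image f"]) (use fge pair_partitions_edge(1)[OF M] in auto)
    thus "(\<Prod>e\<in>image g ` M. w (f ` e)) = prod w M"
      using fge pair_partitions_edge(1)[OF M] by (subst prod.reindex) (auto intro!: prod.cong)
  next
    fix M assume M: "M \<in> pair_partitions S"
    show "image g ` image f ` M = M" by (rule gfM[OF M])
    show "image f ` M \<in> pair_partitions (f ` S)" using pair_partitions_image[OF M assms] .
  qed
qed

section \<open>Planar geometry and the absence of zeros\<close>

text \<open>Divide by one of the numbers, \<open>u a\<close>. All quotients then lie in the right half-plane, where they
  are ordered by their arguments. Turning the one with the least argument onto the positive real axis
  puts the others into the upper half-plane, and they are in the right half-plane because no two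
  of the numbers enclose more than a right angle.\<close>

lemma common_quadrant:
  fixes u :: "'a \<Rightarrow> complex"
  assumes "finite J" "J \<noteq> {}"
    and nz: "\<And>j. j \<in> J \<Longrightarrow> u j \<noteq> 0"
    and angle: "\<And>j k. j \<in> J \<Longrightarrow> k \<in> J \<Longrightarrow> Re (u j * cnj (u k)) \<ge> 0"
  obtains c where "norm c = 1" "\<And>j. j \<in> J \<Longrightarrow> Re (c * u j) \<ge> 0 \<and> Im (c * u j) \<ge> 0"
proof -
  obtain a where a: "a \<in> J" using assms by auto
  define v where "v = (\<lambda>j. u j * cnj (u a))"
  define t where "t = (\<lambda>j. Arg (v j))"
  obtain k where k: "k \<in> J" "\<And>j. j \<in> J \<Longrightarrow> t k \<le> t j"
    using assms(1,2) by (metis arg_min_if_finite(1) arg_min_least)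
  define c where "c = cnj (u k) / norm (u k)"
  have "norm c = 1" using nz[OF k(1)] by (simp add: c_def norm_divide)
  moreover have "Re (c * u j) \<ge> 0 \<and> Im (c * u j) \<ge> 0" if j: "j \<in> J" for j
  proof -
    have ck: "c * u j = u j * cnj (u k) / norm (u k)" by (simp add: c_def)
    have arg: "\<bar>t j\<bar> \<le> pi/2" "\<bar>t k\<bar> \<le> pi/2"
      using angle[OF j a] angle[OF k(1) a] unfolding t_def v_def Arg_Re_nonneg by auto
    have "v j * cnj (v k) = rcis (norm (v j)) (t j) * cnj (rcis (norm (v k)) (t k))"
      by (simp add: t_def rcis_cmod_Arg)
    also have "\<dots> = rcis (norm (v j) * norm (v k)) (t j - t k)"
      by (simp add: rcis_def cis_cnj cis_mult)
    finally have "Im (v j * cnj (v k)) = norm (v j) * norm (v k) * sin (t j - t k)"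
      by (simp add: Im_rcis)
    moreover have "sin (t j - t k) \<ge> 0"
      using arg k(2)[OF j] by (intro sin_ge_zero) auto
    ultimately have "Im (v j * cnj (v k)) \<ge> 0" by simp
    moreover have "v j * cnj (v k) = of_real ((norm (u a))\<^sup>2) * (u j * cnj (u k))"
      by (simp only: v_def complex_norm_square complex_cnj_mult complex_cnj_cnj mult_ac)
    moreover have "Im (of_real r * z) = r * Im z" for r z by simp
    ultimately have "(norm (u a))\<^sup>2 * Im (u j * cnj (u k)) \<ge> 0"
      by metis
    moreover have "(norm (u a))\<^sup>2 > 0" using nz[OF a] by simp
    ultimately have "Im (u j * cnj (u k)) \<ge> 0" by (simp only: zero_le_mult_iff) linarith
    thus ?thesis using angle[OF j k(1)] unfolding ck by (simp add: Re_divide_of_real Im_divide_of_real del: times_complex.sel)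
  qed
  ultimately show ?thesis using that by blast
qed

text \<open>In the first quadrant the norm of a number is at most the sum of its coordinates, and
  coordinates add up. This is where dimension two matters: orthogonal vectors in higher dimension
  would only satisfy a weaker inequality.\<close>

lemma sum_norm_le_of_right_angles:
  fixes u :: "'a \<Rightarrow> complex"
  assumes "finite J"
    and nz: "\<And>j. j \<in> J \<Longrightarrow> u j \<noteq> 0"
    and angle: "\<And>j k. j \<in> J \<Longrightarrow> k \<in> J \<Longrightarrow> Re (u j * cnj (u k)) \<ge> 0"
  shows "(\<Sum>j\<in>J. norm (u j)) \<le> sqrt 2 * norm (\<Sum>j\<in>J. u j)"
proof (cases "J = {}")
  case False
  obtain c where c: "norm c = 1" "\<And>j. j \<in> J \<Longrightarrow> Re (c * u j) \<ge> 0 \<and> Im (c * u j) \<ge> 0"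
    by (rule common_quadrant[of J u]) (use assms False in auto)
  define s where "s = c * (\<Sum>j\<in>J. u j)"
  have "(\<Sum>j\<in>J. norm (u j)) = (\<Sum>j\<in>J. norm (c * u j))" using c by (simp add: norm_mult)
  also have "\<dots> \<le> (\<Sum>j\<in>J. Re (c * u j) + Im (c * u j))"
    using c(2) by (intro sum_mono) (metis abs_of_nonneg cmod_le)
  also have "\<dots> = Re s + Im s"
    by (simp only: s_def sum_distrib_left Re_sum Im_sum sum.distrib)
  also have "\<dots> \<le> sqrt (2 * (norm s)\<^sup>2)"
  proof (rule real_le_rsqrt)
    have "(Re s + Im s)\<^sup>2 \<le> 2 * ((Re s)\<^sup>2 + (Im s)\<^sup>2)"
      using sum_squares_ge_zero[of "Re s - Im s" 0] by (simp add: power2_eq_square algebra_simps)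
    thus "(Re s + Im s)\<^sup>2 \<le> 2 * (norm s)\<^sup>2" by (simp add: cmod_power2)
  qed
  also have "\<dots> = sqrt 2 * norm (\<Sum>j\<in>J. u j)"
    using c by (simp add: real_sqrt_mult s_def norm_mult)
  finally show ?thesis .
qed simp

lemma cone_of_near_one:
  assumes "norm (x - 1) \<le> sqrt 2 / 2"
  shows "\<bar>Im x\<bar> \<le> Re x" "x \<noteq> 0"
proof -
  define p where "p = Re x - 1"
  have "(norm (x - 1))\<^sup>2 \<le> (sqrt 2 / 2)\<^sup>2" using assms by (intro power_mono) auto
  hence pq: "p\<^sup>2 + (Im x)\<^sup>2 \<le> 1/2" by (simp add: cmod_power2 p_def power_divide)
  have "(\<bar>Im x\<bar> - p)\<^sup>2 \<le> 2 * (p\<^sup>2 + (Im x)\<^sup>2)"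
    using sum_squares_ge_zero[of "\<bar>Im x\<bar> + p" 0] by (simp add: power2_eq_square algebra_simps)
  hence "(\<bar>Im x\<bar> - p)\<^sup>2 \<le> 1\<^sup>2" using pq by simp
  hence "\<bar>Im x\<bar> - p \<le> 1" by (rule power2_le_imp_le) simp
  thus "\<bar>Im x\<bar> \<le> Re x" by (simp add: p_def)
  show "x \<noteq> 0" using assms real_sqrt_less_iff[of 2 4] by auto
qed

text \<open>Both combinations differ from \<open>s = (\<Sum>j\<in>J. u j)\<close> by at most half the sum of the norms, so by at
  most \<open>norm s * sqrt 2 / 2\<close>. A disc of that radius around \<open>s\<close> is seen from the origin within
  a quarter turn centred at \<open>s\<close>. The bound \<open>1/2\<close> on the weights is exactly what makes a hypothesis
  about right angles reproduce itself.\<close>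

lemma combinations_nonzero_and_right_angle:
  fixes u :: "'a \<Rightarrow> complex"
  assumes "finite J" "J \<noteq> {}"
    and nz: "\<And>j. j \<in> J \<Longrightarrow> u j \<noteq> 0"
    and angle: "\<And>j k. j \<in> J \<Longrightarrow> k \<in> J \<Longrightarrow> Re (u j * cnj (u k)) \<ge> 0"
    and a: "\<And>j. j \<in> J \<Longrightarrow> norm (1 - a j) \<le> 1/2"
    and b: "\<And>j. j \<in> J \<Longrightarrow> norm (1 - b j) \<le> 1/2"
  shows "(\<Sum>j\<in>J. a j * u j) \<noteq> 0"
    and "Re ((\<Sum>j\<in>J. a j * u j) * cnj (\<Sum>j\<in>J. b j * u j)) \<ge> 0"
proof -
  define s where "s = (\<Sum>j\<in>J. u j)"
  have le: "(\<Sum>j\<in>J. norm (u j)) \<le> sqrt 2 * norm s"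
    unfolding s_def by (rule sum_norm_le_of_right_angles[OF assms(1) nz angle])
  have "(\<Sum>j\<in>J. norm (u j)) > 0" using assms by (intro sum_pos) auto
  hence s0: "s \<noteq> 0" using le by auto
  have near: "norm ((\<Sum>j\<in>J. d j * u j) / s - 1) \<le> sqrt 2 / 2"
    if d: "\<And>j. j \<in> J \<Longrightarrow> norm (1 - d j) \<le> 1/2" for d
  proof -
    have "norm ((\<Sum>j\<in>J. d j * u j) - s) = norm (\<Sum>j\<in>J. (d j - 1) * u j)"
      by (simp add: s_def left_diff_distrib sum_subtractf)
    also have "\<dots> \<le> (\<Sum>j\<in>J. 1/2 * norm (u j))"
    proof (intro order_trans[OF norm_sum] sum_mono)
      fix j assume "j \<in> J"
      thus "norm ((d j - 1) * u j) \<le> 1/2 * norm (u j)"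
        unfolding norm_mult using d[of j] by (intro mult_right_mono) (auto simp: norm_minus_commute)
    qed
    also have "\<dots> \<le> sqrt 2 / 2 * norm s"
      using le by (simp flip: sum_divide_distrib)
    finally show ?thesis
      using s0 by (simp add: divide_simps norm_divide flip: diff_divide_distrib)
  qed
  define x where "x = (\<Sum>j\<in>J. a j * u j) / s"
  define y where "y = (\<Sum>j\<in>J. b j * u j) / s"
  have x: "\<bar>Im x\<bar> \<le> Re x" "x \<noteq> 0"
    using cone_of_near_one[OF near[OF a]] by (simp_all add: x_def)
  have y: "\<bar>Im y\<bar> \<le> Re y"
    using cone_of_near_one[OF near[OF b]] by (simp_all add: y_def)
  show "(\<Sum>j\<in>J. a j * u j) \<noteq> 0" using x(2) by (auto simp: x_def)
  have "\<bar>Im x\<bar> * \<bar>Im y\<bar> \<le> Re x * Re y" using x y by (intro mult_mono) auto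
  hence "Re (x * cnj y) \<ge> 0" by (simp add: abs_mult[symmetric])
  moreover have "(\<Sum>j\<in>J. a j * u j) * cnj (\<Sum>j\<in>J. b j * u j) = of_real ((norm s)\<^sup>2) * (x * cnj y)"
  proof -
    have "(\<Sum>j\<in>J. a j * u j) = s * x" "(\<Sum>j\<in>J. b j * u j) = s * y"
      using s0 by (simp_all add: x_def y_def)
    thus ?thesis by (simp only: complex_norm_square complex_cnj_mult mult_ac)
  qed
  moreover have "Re (of_real r * z) = r * Re z" for r z by simp
  ultimately show "Re ((\<Sum>j\<in>J. a j * u j) * cnj (\<Sum>j\<in>J. b j * u j)) \<ge> 0"
    by (metis mult_nonneg_nonneg zero_le_power2)
qed

definition near_one_on :: "'a set \<Rightarrow> ('a set \<Rightarrow> complex) \<Rightarrow> bool" where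
  "near_one_on S w \<longleftrightarrow> (\<forall>e. e \<subseteq> S \<longrightarrow> card e = 2 \<longrightarrow> norm (1 - w e) \<le> 1/2)"

lemma near_one_on_subset: "near_one_on S w \<Longrightarrow> T \<subseteq> S \<Longrightarrow> near_one_on T w"
  by (auto simp: near_one_on_def)

text \<open>The absence of zeros is strengthened so that an induction works: changing the weights of the
  edges at a single vertex turns the value by at most a right angle. Expand along the row of that
  vertex \<open>i\<close>. The coefficients \<open>matching_sum (S - {i,j}) w\<close> are the same for both weights, and any two of
  them, for \<open>j\<close> and \<open>k\<close>, become values on one common vertex set after exchanging the names \<open>j\<close> and \<open>k\<close>;
  the weights then differ only at one vertex, so the induction hypothesis bounds the angle
  between them.\<close>

lemma matching_sum_zero_free_aux:
  assumes "finite S" "card S = 2 * n"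
  shows "(\<forall>w. near_one_on S w \<longrightarrow> matching_sum S w \<noteq> 0) \<and>
    (\<forall>w w' i. near_one_on S w \<longrightarrow> near_one_on S w' \<longrightarrow> i \<in> S \<longrightarrow>
       (\<forall>e. e \<subseteq> S \<longrightarrow> card e = 2 \<longrightarrow> i \<notin> e \<longrightarrow> w e = w' e) \<longrightarrow>
       Re (matching_sum S w * cnj (matching_sum S w')) \<ge> 0)"
  using assms
proof (induction n arbitrary: S)
  case 0
  thus ?case by (auto simp: matching_sum_empty)
next
  case (Suc n)
  have row: "matching_sum S w \<noteq> 0 \<and> Re (matching_sum S w * cnj (matching_sum S w')) \<ge> 0"
    if w: "near_one_on S w" and w': "near_one_on S w'" and i: "i \<in> S"
      and eq: "\<And>e. e \<subseteq> S \<Longrightarrow> card e = 2 \<Longrightarrow> i \<notin> e \<Longrightarrow> w e = w' e" for w w' i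
  proof -
    define J where "J = S - {i}"
    define u where "u = (\<lambda>j. matching_sum (S - {i,j}) w)"
    have J: "finite J" "card J = 2 * n + 1" using Suc.prems i by (auto simp: J_def)
    have card: "card (S - {i,j}) = 2 * n" "finite (S - {i,j})" if "j \<in> J" for j
      using that Suc.prems i by (auto simp: J_def card_Diff_subset)
    note IH = Suc.IH[OF card(2) card(1)]
    have nz: "u j \<noteq> 0" if "j \<in> J" for j
      using IH[OF that that] near_one_on_subset[OF w, of "S - {i,j}"] by (auto simp: u_def)
    have angle: "Re (u j * cnj (u k)) \<ge> 0" if j: "j \<in> J" and k: "k \<in> J" for j k
    proof (cases "j = k")
      case False
      (* Exchanging j and k maps S - {i,j} to S - {i,k} and moves only edges at k. *)
      define \<tau> where "\<tau> = Transposition.transpose j k"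
      have img: "\<tau> ` (S - {i,j}) = S - {i,k}"
        using j k False by (auto simp: \<tau>_def J_def Transposition.transpose_def image_iff)
      have inj: "inj_on \<tau> A" for A unfolding \<tau>_def by (metis inj_onI transpose_involutory)
      have uk: "u k = matching_sum (S - {i,j}) (\<lambda>e. w (\<tau> ` e))"
        using matching_sum_image[OF inj, of "S - {i,j}" w] by (simp add: u_def img)
      have "near_one_on (S - {i,j}) (\<lambda>e. w (\<tau> ` e))"
        unfolding near_one_on_def
      proof (intro allI impI)
        fix e assume "e \<subseteq> S - {i,j}" "card e = 2"
        hence "\<tau> ` e \<subseteq> S" "card (\<tau> ` e) = 2" using img inj by (auto simp: card_image)
        thus "norm (1 - w (\<tau> ` e)) \<le> 1/2" using w by (auto simp: near_one_on_def)
      qed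
      moreover have "w e = w (\<tau> ` e)" if "e \<subseteq> S - {i,j}" "k \<notin> e" for e
      proof -
        have "\<tau> ` e = (\<lambda>x. x) ` e"
          using that by (intro image_cong) (auto simp: \<tau>_def Transposition.transpose_def)
        thus ?thesis by simp
      qed
      moreover have "k \<in> S - {i,j}" using k False by (auto simp: J_def)
      ultimately show ?thesis
        using IH[OF j j] near_one_on_subset[OF w, of "S - {i,j}"] unfolding uk unfolding u_def
        by blast
    qed (simp add: complex_norm_square[symmetric])
    have edge: "{i,j} \<subseteq> S" "card {i,j} = 2" if "j \<in> J" for j
      using that i by (auto simp: J_def)
    have ms: "matching_sum S w = (\<Sum>j\<in>J. w {i,j} * u j)"
      unfolding J_def u_def by (rule matching_sum_row[OF Suc.prems(1) i])
    have ms': "matching_sum S w' = (\<Sum>j\<in>J. w' {i,j} * u j)"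
      unfolding matching_sum_row[OF Suc.prems(1) i] J_def u_def
      by (intro sum.cong arg_cong2[of _ _ _ _ "(*)"] refl matching_sum_cong eq[symmetric]) auto
    have "J \<noteq> {}" using J by auto
    moreover have "norm (1 - w {i,j}) \<le> 1/2" "norm (1 - w' {i,j}) \<le> 1/2" if "j \<in> J" for j
      using w w' edge[OF that] by (auto simp: near_one_on_def)
    ultimately show ?thesis unfolding ms ms'
      using combinations_nonzero_and_right_angle[of J u "\<lambda>j. w {i,j}" "\<lambda>j. w' {i,j}"] J(1) nz angle
      by blast
  qed
  obtain i where "i \<in> S" using Suc.prems by (metis card.empty ex_in_conv mult_eq_0_iff nat.distinct(1) zero_neq_numeral)
  thus ?case using row by blast
qed

lemma matching_sum_nonzero:
  assumes "finite S" "even (card S)" "near_one_on S w"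
  shows "matching_sum S w \<noteq> 0"
  using matching_sum_zero_free_aux[OF assms(1), of "card S div 2"] assms by auto

lemma matching_sum_row_angle:
  assumes "finite S" "even (card S)" "near_one_on S w" "near_one_on S w'" "i \<in> S"
    and "\<And>e. e \<subseteq> S \<Longrightarrow> card e = 2 \<Longrightarrow> i \<notin> e \<Longrightarrow> w e = w' e"
  shows "Re (matching_sum S w * cnj (matching_sum S w')) \<ge> 0"
  using matching_sum_zero_free_aux[OF assms(1), of "card S div 2"] assms by auto

section \<open>The branch of the logarithm of the hafnian\<close>

lemma haf_conv_matching_sum:
  "haf A = matching_sum {..<dim_row A} (\<lambda>e. A $$ (Min e, Max e))"
  by (simp add: haf_def matching_sum_def)

lemma Min_Max_edge_less:
  fixes e :: "nat set"
  assumes "e \<subseteq> {..<N}" "card e = 2"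
  shows "Min e < N" "Max e < N"
proof -
  have "finite e" "e \<noteq> {}" using assms by (auto intro: card_ge_0_finite)
  thus "Min e < N" "Max e < N" using assms Min_in Max_in by blast+
qed

lemma near_one_on_entries:
  assumes "A \<in> sym_near_ones n (1/2)"
  shows "near_one_on {..<2*n} (\<lambda>e. A $$ (Min e, Max e))"
  using assms Min_Max_edge_less by (auto simp: near_one_on_def sym_near_ones_def)

abbreviation number_of_matchings :: "nat \<Rightarrow> nat" where
  "number_of_matchings n \<equiv> card (pair_partitions {..<2*n})"

lemma matching_sum_one: "matching_sum {..<2*n} (\<lambda>e. 1) = of_nat (number_of_matchings n)"
  by (simp add: matching_sum_def)

text \<open>The all-ones weight is a special case of the absence of zeros.\<close>

lemma number_of_matchings_pos: "number_of_matchings n > 0"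
proof -
  have "matching_sum {..<2*n} (\<lambda>e. 1 :: complex) \<noteq> 0"
    by (rule matching_sum_nonzero) (auto simp: near_one_on_def)
  thus ?thesis unfolding matching_sum_one by (metis gr0I of_nat_0)
qed

text \<open>The hafnian of the matrix obtained from the all-ones matrix by putting in the first \<open>k\<close> rows and
  columns of \<open>A\<close>.\<close>

definition first_rows_haf :: "nat \<Rightarrow> nat \<Rightarrow> complex mat \<Rightarrow> complex" where
  "first_rows_haf n k A =
     matching_sum {..<2*n} (\<lambda>e. if \<exists>i\<in>e. i < k then A $$ (Min e, Max e) else 1)"

text \<open>Passing from the all-ones matrix to \<open>A\<close> one row at a time multiplies the hafnian by factors in the
  closed right half-plane without the origin. There the principal logarithm is continuous, so adding
  up these logarithms gives a branch on all of the domain without an appeal to simple connectedness.\<close>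

definition row_by_row_log :: "nat \<Rightarrow> complex mat \<Rightarrow> complex" where
  "row_by_row_log n A = of_real (ln (number_of_matchings n)) +
     (\<Sum>k<2*n. Ln (first_rows_haf n (Suc k) A / first_rows_haf n k A))"

lemma first_rows_haf_0: "first_rows_haf n 0 A = of_nat (number_of_matchings n)"
  by (simp add: first_rows_haf_def matching_sum_one)

lemma first_rows_haf_all:
  assumes "dim_row A = 2 * n"
  shows "first_rows_haf n (2 * n) A = haf A"
  unfolding first_rows_haf_def haf_conv_matching_sum assms
proof (rule matching_sum_cong)
  fix e :: "nat set" assume e: "e \<subseteq> {..<2*n}" "card e = 2"
  hence "e \<noteq> {}" by auto
  hence "\<exists>i\<in>e. i < 2 * n" using e by blast
  thus "(if \<exists>i\<in>e. i < 2 * n then A $$ (Min e, Max e) else 1) = A $$ (Min e, Max e)" by simp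
qed

lemma near_one_on_first_rows:
  assumes "A \<in> sym_near_ones n (1/2)"
  shows "near_one_on {..<2*n} (\<lambda>e. if \<exists>i\<in>e. i < k then A $$ (Min e, Max e) else 1)"
  using near_one_on_entries[OF assms] by (auto simp: near_one_on_def)

lemma first_rows_haf_nonzero:
  assumes "A \<in> sym_near_ones n (1/2)"
  shows "first_rows_haf n k A \<noteq> 0"
  unfolding first_rows_haf_def
  by (rule matching_sum_nonzero) (use near_one_on_first_rows[OF assms] in auto)

lemma first_rows_haf_ratio:
  assumes "A \<in> sym_near_ones n (1/2)" "k < 2 * n"
  defines "q \<equiv> first_rows_haf n (Suc k) A / first_rows_haf n k A"
  shows "q \<noteq> 0" "Re q \<ge> 0" "q \<notin> \<real>\<^sub>\<le>\<^sub>0"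
proof -
  show q: "q \<noteq> 0" using first_rows_haf_nonzero[OF assms(1)] by (simp add: q_def)
  have "Re (first_rows_haf n (Suc k) A * cnj (first_rows_haf n k A)) \<ge> 0"
    unfolding first_rows_haf_def
  proof (rule matching_sum_row_angle[where i = k])
    fix e assume "k \<notin> e"
    hence "(\<exists>i\<in>e. i < Suc k) \<longleftrightarrow> (\<exists>i\<in>e. i < k)" by (metis less_Suc_eq)
    thus "(if \<exists>i\<in>e. i < Suc k then A $$ (Min e, Max e) else 1) =
          (if \<exists>i\<in>e. i < k then A $$ (Min e, Max e) else 1)" by simp
  qed (use assms near_one_on_first_rows in auto)
  hence "Re (first_rows_haf n (Suc k) A * cnj (first_rows_haf n k A)) / (cmod (first_rows_haf n k A))\<^sup>2 \<ge> 0"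
    by (intro divide_nonneg_nonneg) auto
  thus re: "Re q \<ge> 0"
    unfolding q_def complex_div_cnj[of "first_rows_haf n (Suc k) A"] by (metis Re_divide_of_real of_real_power)
  show "q \<notin> \<real>\<^sub>\<le>\<^sub>0"
    using q re by (auto simp: complex_nonpos_Reals_iff complex_eq_iff)
qed

lemma exp_row_by_row_log:
  assumes "A \<in> sym_near_ones n (1/2)"
  shows "exp (row_by_row_log n A) = haf A"
proof -
  let ?H = "\<lambda>k. first_rows_haf n k A"
  have "exp (row_by_row_log n A) =
      of_nat (number_of_matchings n) * (\<Prod>k<2*n. exp (Ln (?H (Suc k) / ?H k)))"
    using number_of_matchings_pos[of n]
    by (simp add: row_by_row_log_def exp_add exp_sum exp_of_real)
  also have "(\<Prod>k<2*n. exp (Ln (?H (Suc k) / ?H k))) = (\<Prod>k<2*n. ?H (Suc k) / ?H k)"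
    using first_rows_haf_nonzero[OF assms] by (intro prod.cong) auto
  also have "\<dots> = ?H (2*n) / ?H 0"
    using first_rows_haf_nonzero[OF assms] by (intro prod_lessThan_telescope) auto
  finally show ?thesis
    using assms number_of_matchings_pos[of n] first_rows_haf_all[of A n]
    by (auto simp: first_rows_haf_0 sym_near_ones_def)
qed

lemma row_by_row_log_real:
  assumes "A \<in> sym_near_ones n (1/2)" "\<forall>i<2*n. \<forall>j<2*n. A $$ (i,j) \<in> \<real>"
  shows "row_by_row_log n A \<in> \<real>"
proof -
  have H: "first_rows_haf n k A \<in> \<real>" for k
    unfolding first_rows_haf_def matching_sum_def
  proof (intro sum_in_Reals prod_in_Reals)
    fix M and e :: "nat set" assume "M \<in> pair_partitions {..<2*n}" "e \<in> M"
    hence "Min e < 2 * n" "Max e < 2 * n"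
      by (meson Min_Max_edge_less pair_partitions_edge)+
    thus "(if \<exists>i\<in>e. i < k then A $$ (Min e, Max e) else 1) \<in> \<real>" using assms(2) by simp
  qed
  have "Ln (first_rows_haf n (Suc k) A / first_rows_haf n k A) \<in> \<real>" if "k < 2 * n" for k
  proof -
    obtain r where r: "first_rows_haf n (Suc k) A / first_rows_haf n k A = of_real r"
      using H Reals_divide Reals_cases by metis
    hence "r > 0" using first_rows_haf_ratio[OF assms(1) that] by (simp add: order_le_less)
    thus ?thesis unfolding r by (simp add: Ln_of_real)
  qed
  thus ?thesis unfolding row_by_row_log_def by (intro Reals_add sum_in_Reals) auto
qed

lemma continuous_on_matching_sum [continuous_intros]:
  fixes w :: "'a::topological_space \<Rightarrow> 'b set \<Rightarrow> complex"
  assumes "\<And>e. e \<subseteq> S \<Longrightarrow> card e = 2 \<Longrightarrow> continuous_on T (\<lambda>x. w x e)"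
  shows "continuous_on T (\<lambda>x. matching_sum S (w x))"
  unfolding matching_sum_def
  by (intro continuous_on_sum continuous_on_prod assms) (auto dest: pair_partitions_edge)

lemma continuous_on_row_by_row_log:
  "continuous_on {a. Matrix.mat (2 * n) (2 * n) a \<in> sym_near_ones n (1/2)}
     (\<lambda>a. row_by_row_log n (Matrix.mat (2 * n) (2 * n) a))"
proof -
  let ?D = "{a :: nat \<times> nat \<Rightarrow> complex. Matrix.mat (2 * n) (2 * n) a \<in> sym_near_ones n (1/2)}"
  have H: "continuous_on ?D (\<lambda>a. first_rows_haf n k (Matrix.mat (2 * n) (2 * n) a))" for k
    unfolding first_rows_haf_def
  proof (rule continuous_on_matching_sum)
    fix e :: "nat set" assume e: "e \<subseteq> {..<2*n}" "card e = 2"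
    have "continuous_on ?D (\<lambda>a. if \<exists>i\<in>e. i < k then a (Min e, Max e) else 1)"
      by (cases "\<exists>i\<in>e. i < k")
         (auto intro: continuous_on_subset[OF continuous_on_product_coordinates])
    thus "continuous_on ?D (\<lambda>a. if \<exists>i\<in>e. i < k then Matrix.mat (2*n) (2*n) a $$ (Min e, Max e) else 1)"
      by (simp only: index_mat(1)[OF Min_Max_edge_less[OF e]])
  qed
  show ?thesis unfolding row_by_row_log_def
    using first_rows_haf_ratio(3) first_rows_haf_nonzero
    by (intro continuous_intros H) auto
qed

lemma is_ln_haf_branch_ln_haf: "is_ln_haf_branch n (ln_haf n)"
proof -
  have "is_ln_haf_branch n (row_by_row_log n)"
    unfolding is_ln_haf_branch_def
    using continuous_on_row_by_row_log exp_row_by_row_log row_by_row_log_real by blast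
  thus ?thesis unfolding ln_haf_def by (rule someI[of "is_ln_haf_branch n"])
qed

text \<open>The difference takes values in the discrete set of multiples of \<open>2 * pi * \<i>\<close>.\<close>

lemma continuous_logarithms_agree:
  fixes f g :: "real \<Rightarrow> complex"
  assumes "continuous_on {0..1} f" "continuous_on {0..1} g"
    and exp: "\<And>t. t \<in> {0..1} \<Longrightarrow> exp (f t) = exp (g t)"
    and "f 0 = g 0"
  shows "f 1 = g 1"
proof -
  have "(\<lambda>t. f t - g t) constant_on {0..1}"
  proof (rule continuous_discrete_range_constant)
    show "continuous_on {0..1} (\<lambda>t. f t - g t)" using assms by (intro continuous_intros)
    fix s :: real assume s: "s \<in> {0..1}"
    have "2 * pi \<le> norm ((f t - g t) - (f s - g s))"
      if t: "t \<in> {0..1}" and ne: "f t - g t \<noteq> f s - g s" for t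
    proof -
      obtain k l :: int where kl: "f t = g t + of_int (2 * k) * pi * \<i>" "f s = g s + of_int (2 * l) * pi * \<i>"
        using exp[OF t] exp[OF s] by (auto simp: exp_eq)
      have "(f t - g t) - (f s - g s) = 2 * of_int (k - l) * pi * \<i>"
        by (simp add: kl algebra_simps)
      hence "norm ((f t - g t) - (f s - g s)) = 2 * pi * \<bar>of_int (k - l)\<bar>"
        by (simp add: norm_mult del: of_int_diff)
      moreover have "k \<noteq> l" using ne kl by auto
      hence "\<bar>of_int (k - l)\<bar> \<ge> (1::real)" by linarith
      ultimately show ?thesis by (simp del: of_int_diff)
    qed
    thus "\<exists>e>0. \<forall>t. t \<in> {0..1} \<and> f t - g t \<noteq> f s - g s \<longrightarrow> e \<le> norm ((f t - g t) - (f s - g s))"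
      by (intro exI[of _ "2 * pi"]) auto
  qed simp
  hence "f 1 - g 1 = f 0 - g 0" by (fastforce simp: constant_on_def)
  thus ?thesis using assms by simp
qed

text \<open>The segment from the all-ones matrix to \<open>A\<close> stays in the domain, and the branch is real at its
  start. So any continuous logarithm along the segment with the right initial value computes \<open>ln_haf n A\<close>,
  whichever branch the choice operator selected.\<close>

lemma ln_haf_eq_end_of_segment:
  assumes A: "A \<in> sym_near_ones n (1/2)"
    and h: "continuous_on {0..1} h"
    and exp: "\<And>t. t \<in> {0..1} \<Longrightarrow>
      exp (h t) = matching_sum {..<2*n} (\<lambda>e. 1 + of_real t * (A $$ (Min e, Max e) - 1))"
    and h0: "h 0 = of_real (ln (number_of_matchings n))"
  shows "ln_haf n A = h 1"
proof -
  define a where "a = (\<lambda>t::real. \<lambda>x. 1 + of_real t * (A $$ x - 1))"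
  define P where "P = (\<lambda>t. Matrix.mat (2 * n) (2 * n) (a t))"
  define L where "L = ln_haf n"
  have L: "continuous_on {a. Matrix.mat (2 * n) (2 * n) a \<in> sym_near_ones n (1/2)} (\<lambda>a. L (Matrix.mat (2 * n) (2 * n) a))"
     "\<And>A. A\<in>sym_near_ones n (1/2) \<Longrightarrow> exp (L A) = haf A"
     "\<And>A. A\<in>sym_near_ones n (1/2) \<Longrightarrow> \<forall>i<2 * n. \<forall>j<2 * n. A $$ (i, j) \<in> \<real> \<Longrightarrow> L A \<in> \<real>"
    using is_ln_haf_branch_ln_haf[of n] unfolding is_ln_haf_branch_def L_def by blast+
  have dim: "dim_row A = 2 * n" "dim_col A = 2 * n" and sym: "transpose_mat A = A"
    and near: "\<And>i j. i < 2 * n \<Longrightarrow> j < 2 * n \<Longrightarrow> norm (1 - A $$ (i,j)) \<le> 1/2"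
    using A by (auto simp: sym_near_ones_def)
  have P: "P t \<in> sym_near_ones n (1/2)" if t: "t \<in> {0..1}" for t
  proof -
    have "A $$ (j,i) = A $$ (i,j)" if "i < 2 * n" "j < 2 * n" for i j
      using sym dim that by (metis index_transpose_mat(1))
    hence "transpose_mat (P t) = P t" by (intro eq_matI) (auto simp: P_def a_def)
    moreover have "norm (1 - P t $$ (i,j)) \<le> 1/2" if "i < 2 * n" "j < 2 * n" for i j
    proof -
      have "norm (1 - P t $$ (i,j)) = t * norm (1 - A $$ (i,j))"
        using that t by (simp add: P_def a_def norm_mult norm_minus_commute)
      also have "\<dots> \<le> 1 * (1/2)" using near[OF that] t by (intro mult_mono) auto
      finally show ?thesis by simp
    qed
    ultimately show ?thesis by (simp add: sym_near_ones_def P_def)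
  qed
  have hafP: "haf (P t) = matching_sum {..<2*n} (\<lambda>e. 1 + of_real t * (A $$ (Min e, Max e) - 1))" for t
    unfolding haf_conv_matching_sum
    by (auto intro!: matching_sum_cong simp: P_def a_def Min_Max_edge_less)
  have "continuous_on {0..1} a" unfolding a_def
    by (intro continuous_intros)
  hence "continuous_on {0..1} ((\<lambda>a. L (Matrix.mat (2*n) (2*n) a)) \<circ> a)"
    using P by (intro continuous_on_compose continuous_on_subset[OF L(1)]) (auto simp: P_def)
  hence "continuous_on {0..1} (\<lambda>t. L (P t))" by (simp add: o_def P_def)
  moreover have "exp (L (P t)) = exp (h t)" if "t \<in> {0..1}" for t
    using L(2)[OF P[OF that]] exp[OF that] hafP by simp
  moreover have "L (P 0) = h 0"
  proof -
    have "L (P 0) \<in> \<real>" by (rule L(3)[OF P]) (auto simp: P_def a_def)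
    then obtain r where r: "L (P 0) = of_real r" by (auto elim: Reals_cases)
    have "exp (of_real r :: complex) = of_real (number_of_matchings n)"
      using L(2)[OF P, of 0] hafP[of 0] by (simp add: r matching_sum_one)
    hence "exp r = number_of_matchings n"
      by (metis exp_of_real of_real_eq_iff)
    thus ?thesis unfolding r h0 by (metis ln_exp)
  qed
  ultimately have "L (P 1) = h 1"
    by (rule continuous_logarithms_agree[where f = "\<lambda>t. L (P t)", OF _ h])
  moreover have "P 1 = A" using dim by (intro eq_matI) (auto simp: P_def a_def)
  ultimately show ?thesis by (simp add: L_def)
qed

section \<open>Taylor coefficients of the logarithm of a complex polynomial\<close>

text \<open>Factoring into \<open>1 - r z\<close> with inverse roots \<open>r\<close>, not into \<open>z - \<rho>\<close>, keeps the logarithm of each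
  factor a power series at the origin. A degree below the expected one costs nothing: it only
  means fewer inverse roots.\<close>

lemma inverse_root_factorization:
  fixes p :: "complex poly"
  assumes "poly p 0 \<noteq> 0"
  shows "\<exists>rs. p = Polynomial.smult (poly p 0) (\<Prod>r\<leftarrow>rs. [:1, -r:]) \<and> length rs \<le> Polynomial.degree p"
  using assms
proof (induction "Polynomial.degree p" arbitrary: p)
  case 0
  then obtain c where "p = [:c:]" by (metis degree_eq_zeroE)
  thus ?case by (intro exI[of _ "[]"]) auto
next
  case (Suc d)
  hence "\<not> constant (poly p)" by (simp add: constant_degree)
  then obtain x where x: "poly p x = 0" using fundamental_theorem_of_algebra by blast
  then obtain q where q: "p = [:-x, 1:] * q" by (auto simp: poly_eq_0_iff_dvd)
  have x0: "x \<noteq> 0" using x Suc.prems by auto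
  have "q \<noteq> 0" using Suc.prems q by auto
  hence deg: "Polynomial.degree p = Suc (Polynomial.degree q)"
    unfolding q by (subst degree_mult_eq) auto
  define q' where "q' = Polynomial.smult (-x) q"
  have "[:-x, 1:] = Polynomial.smult (-x) [:1, -(1/x):]" using x0 by simp
  hence p: "p = [:1, -(1/x):] * q'"
    by (simp only: q q'_def mult_smult_left mult_smult_right)
  have "poly q' 0 = poly p 0" by (simp add: p)
  moreover have "Polynomial.degree q' = d" using deg Suc.hyps x0 by (simp add: q'_def)
  ultimately obtain rs where rs: "q' = Polynomial.smult (poly p 0) (\<Prod>r\<leftarrow>rs. [:1, -r:])" "length rs \<le> d"
    using Suc.hyps(1)[of q'] Suc.prems by auto
  have "p = Polynomial.smult (poly p 0) (\<Prod>r\<leftarrow>1/x # rs. [:1, -r:])"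
    using p rs(1) by (simp only: list.map prod_list.Cons mult_smult_right)
  thus ?case using rs(2) Suc.hyps(2) by (intro exI[of _ "1/x # rs"]) (simp only: list.size, simp)
qed

text \<open>The logarithmic derivative of \<open>1 - r z\<close> is the geometric series \<open>- (\<Sum>i. r ^ Suc i * z ^ i)\<close>, and
  logarithmic derivatives of products add.\<close>

lemma fps_deriv_prod_linear:
  fixes rs :: "complex list"
  shows "fps_deriv (fps_of_poly (\<Prod>r\<leftarrow>rs. [:1, -r:])) =
    fps_of_poly (\<Prod>r\<leftarrow>rs. [:1, -r:]) * Abs_fps (\<lambda>i. - (\<Sum>r\<leftarrow>rs. r ^ Suc i))"
proof (induction rs)
  case Nil
  have "Abs_fps (\<lambda>i. 0) = (0 :: complex fps)" by (rule fps_ext) simp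
  thus ?case by simp
next
  case (Cons r rs)
  define p where "p = fps_of_poly (\<Prod>r\<leftarrow>rs. [:1, -r:])"
  define l where "l = fps_of_poly [:1, -r:]"
  define H where "H = Abs_fps (\<lambda>i. - (\<Sum>r\<leftarrow>rs. r ^ Suc i))"
  define G where "G = Abs_fps (\<lambda>i. - (r ^ Suc i))"
  have l: "l = 1 - fps_const r * fps_X"
    by (simp add: l_def fps_of_poly_pCons fps_const_neg[symmetric] del: fps_const_neg)
  have "l * G = fps_const (-r)"
  proof (rule fps_ext)
    fix k show "fps_nth (l * G) k = fps_nth (fps_const (-r)) k"
      by (cases k) (simp_all add: l G_def left_diff_distrib mult.assoc)
  qed
  moreover have "fps_deriv l = fps_const (-r)" by (simp add: l)
  ultimately have l': "fps_deriv l = l * G" by simp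
  have "fps_deriv (l * p) = l * (p * H) + l * G * p"
    using Cons.IH by (simp add: l' p_def H_def)
  also have "\<dots> = l * p * (H + G)" by (simp add: algebra_simps)
  also have "H + G = Abs_fps (\<lambda>i. - (\<Sum>r\<leftarrow>r # rs. r ^ Suc i))"
    by (rule fps_ext) (simp add: H_def G_def)
  also have "l * p = fps_of_poly (\<Prod>r\<leftarrow>r # rs. [:1, -r:])"
    unfolding l_def p_def list.map prod_list.Cons fps_of_poly_mult ..
  finally show ?case .
qed

text \<open>Newton's identities. They express the power sums of the inverse roots, which
  are the Taylor coefficients of the logarithm, through the coefficients of the polynomial.\<close>

lemma newton_identity:
  fixes rs :: "complex list"
  assumes "p = Polynomial.smult c (\<Prod>r\<leftarrow>rs. [:1, -r:])"
  shows "of_nat (Suc k) * Polynomial.coeff p (Suc k) =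
    - (\<Sum>i\<le>k. Polynomial.coeff p (k - i) * (\<Sum>r\<leftarrow>rs. r ^ Suc i))"
proof -
  define q where "q = (\<Prod>r\<leftarrow>rs. [:1, -r:])"
  have "of_nat (Suc k) * Polynomial.coeff q (Suc k) = fps_nth (fps_deriv (fps_of_poly q)) k"
    by (simp add: fps_deriv_nth)
  also have "\<dots> = fps_nth (Abs_fps (\<lambda>i. - (\<Sum>r\<leftarrow>rs. r ^ Suc i)) * fps_of_poly q) k"
    unfolding q_def fps_deriv_prod_linear by (simp only: mult.commute)
  also have "\<dots> = (\<Sum>i\<le>k. - (\<Sum>r\<leftarrow>rs. r ^ Suc i) * Polynomial.coeff q (k - i))"
    by (simp add: fps_mult_nth atMost_atLeast0)
  also have "\<dots> = - (\<Sum>i\<le>k. Polynomial.coeff q (k - i) * (\<Sum>r\<leftarrow>rs. r ^ Suc i))"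
    by (simp add: sum_negf mult.commute)
  finally have "c * (of_nat (Suc k) * Polynomial.coeff q (Suc k)) =
    c * - (\<Sum>i\<le>k. Polynomial.coeff q (k - i) * (\<Sum>r\<leftarrow>rs. r ^ Suc i))" by (rule arg_cong)
  thus ?thesis unfolding assms q_def[symmetric]
    by (simp add: sum_distrib_left mult_ac del: of_nat_Suc power_Suc)
qed

text \<open>The tail of the logarithm series is dominated by a geometric series.\<close>

lemma Ln_truncation_error:
  fixes r :: complex
  assumes "norm r < 1"
  shows "norm (Ln (1 - r) - (\<Sum>k<m. - (r ^ Suc k) / of_nat (Suc k))) \<le> norm r ^ Suc m / (1 - norm r)"
proof -
  define f where "f = (\<lambda>k. - (r ^ k) / of_nat k)"
  have "f sums Ln (1 - r)" using Ln_series'[of "-r"] assms by (simp add: f_def)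
  hence "(\<lambda>k. f (k + Suc m)) sums (Ln (1 - r) - (\<Sum>k<Suc m. f k))"
    by (rule sums_split_initial_segment)
  moreover have "(\<lambda>k. norm r ^ Suc m * norm r ^ k) sums (norm r ^ Suc m * (1 / (1 - norm r)))"
    using assms by (intro sums_mult geometric_sums) auto
  moreover have "norm (f (k + Suc m)) \<le> norm r ^ Suc m * norm r ^ k" for k
  proof -
    have "norm (f (k + Suc m)) = norm r ^ (Suc m + k) / real (k + Suc m)"
      by (simp add: f_def norm_divide norm_mult norm_power add.commute del: of_nat_add of_nat_Suc)
    also have "\<dots> \<le> norm r ^ (Suc m + k) / 1"
      by (intro divide_left_mono) auto
    finally show ?thesis by (simp add: power_add)
  qed
  ultimately have "norm (Ln (1 - r) - (\<Sum>k<Suc m. f k)) \<le> norm r ^ Suc m * (1 / (1 - norm r))"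
    by (rule norm_sums_le)
  moreover have "(\<Sum>k<Suc m. f k) = (\<Sum>k<m. f (Suc k))"
    unfolding sum.lessThan_Suc_shift by (simp add: f_def)
  ultimately show ?thesis by (simp add: f_def)
qed

lemma sum_Ln_truncation_error:
  assumes "\<And>r. r \<in> set rs \<Longrightarrow> norm r \<le> b" "b < 1"
  shows "norm ((\<Sum>r\<leftarrow>rs. Ln (1 - r)) - (\<Sum>k<m. - (\<Sum>r\<leftarrow>rs. r ^ Suc k) / of_nat (Suc k)))
    \<le> length rs * (b ^ Suc m / (1 - b))"
  using assms(1)
proof (induction rs)
  case (Cons r rs)
  have "norm r \<le> b" using Cons.prems by simp
  have "norm (Ln (1 - r) - (\<Sum>k<m. - (r ^ Suc k) / of_nat (Suc k))) \<le> norm r ^ Suc m / (1 - norm r)"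
    using \<open>norm r \<le> b\<close> assms(2) by (intro Ln_truncation_error) auto
  also have "\<dots> \<le> b ^ Suc m / (1 - b)"
    using \<open>norm r \<le> b\<close> assms(2) order_trans[OF norm_ge_zero \<open>norm r \<le> b\<close>]
    by (intro frac_le power_mono) auto
  finally have 1: "norm (Ln (1 - r) - (\<Sum>k<m. - (r ^ Suc k) / of_nat (Suc k))) \<le> b ^ Suc m / (1 - b)" .
  define u where "u = Ln (1 - r) - (\<Sum>k<m. - (r ^ Suc k) / of_nat (Suc k))"
  define v where "v = (\<Sum>r\<leftarrow>rs. Ln (1 - r)) - (\<Sum>k<m. - (\<Sum>r\<leftarrow>rs. r ^ Suc k) / of_nat (Suc k))"
  have split: "(\<Sum>k<m. - (\<Sum>r\<leftarrow>r#rs. r ^ Suc k) / of_nat (Suc k)) =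
    (\<Sum>k<m. - (r ^ Suc k) / of_nat (Suc k)) + (\<Sum>k<m. - (\<Sum>r\<leftarrow>rs. r ^ Suc k) / of_nat (Suc k))"
    unfolding sum.distrib[symmetric] by (intro sum.cong refl) (simp add: add_divide_distrib diff_divide_distrib)
  have "(\<Sum>r\<leftarrow>r#rs. Ln (1 - r)) - (\<Sum>k<m. - (\<Sum>r\<leftarrow>r#rs. r ^ Suc k) / of_nat (Suc k)) = u + v"
    unfolding split u_def v_def by simp
  also have "norm (u + v) \<le> b ^ Suc m / (1 - b) + length rs * (b ^ Suc m / (1 - b))"
    using 1 Cons.IH Cons.prems by (intro norm_triangle_mono) (auto simp: u_def v_def)
  also have "\<dots> = length (r # rs) * (b ^ Suc m / (1 - b))"
    by (simp add: add_divide_distrib distrib_right del: power_Suc)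
  finally show ?case .
qed simp

section \<open>The hafnian along the line through the all-ones matrix\<close>

text \<open>The polynomial \<open>z \<mapsto> haf (J + z (A - J))\<close> for the all-ones matrix \<open>J\<close> and the matrix \<open>A\<close> with
  entries \<open>x\<close>.\<close>

definition haf_line :: "nat \<Rightarrow> (nat \<times> nat \<Rightarrow> complex) \<Rightarrow> complex poly" where
  "haf_line n x = matching_sum {..<2*n} (\<lambda>e. [:1, x (Min e, Max e) - 1:])"

lemma poly_haf_line:
  "poly (haf_line n x) z = matching_sum {..<2*n} (\<lambda>e. 1 + z * (x (Min e, Max e) - 1))"
  by (simp add: haf_line_def matching_sum_def poly_sum poly_prod)

lemma coeff_haf_line_0: "Polynomial.coeff (haf_line n x) 0 = of_nat (number_of_matchings n)"
  using poly_haf_line[of n x 0] by (simp add: poly_0_coeff_0 matching_sum_one)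

lemma degree_haf_line: "Polynomial.degree (haf_line n x) \<le> n"
  unfolding haf_line_def matching_sum_def
proof (rule degree_sum_le)
  show "finite (pair_partitions {..<2*n})" by (simp add: finite_pair_partitions)
  fix M assume M: "M \<in> pair_partitions {..<2*n}"
  have "Polynomial.degree (\<Prod>e\<in>M. [:1, x (Min e, Max e) - 1:])
      \<le> sum (Polynomial.degree \<circ> (\<lambda>e. [:1, x (Min e, Max e) - 1:])) M"
    using M by (intro degree_prod_sum_le) (auto intro: finite_matching[OF finite_lessThan])
  also have "\<dots> \<le> (\<Sum>e\<in>M. 1)" by (intro sum_mono) simp
  also have "\<dots> = n" using card_matching[OF M] by simp
  finally show "Polynomial.degree (\<Prod>e\<in>M. [:1, x (Min e, Max e) - 1:]) \<le> n" .
qed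

text \<open>The \<open>k\<close>-th coefficient of the logarithmic derivative of \<open>haf_line n x\<close>, obtained by solving
  Newton's identities recursively. The only division is by the constant coefficient, which does not
  depend on \<open>x\<close>; this is why the result is a polynomial in \<open>x\<close>.\<close>

function log_coeff :: "nat \<Rightarrow> (nat \<times> nat \<Rightarrow> complex) \<Rightarrow> nat \<Rightarrow> complex" where
  "log_coeff n x k = (of_nat (Suc k) * Polynomial.coeff (haf_line n x) (Suc k)
     - (\<Sum>i\<in>{..<k}. Polynomial.coeff (haf_line n x) (k - i) * log_coeff n x i)) / of_nat (number_of_matchings n)"
  by auto
termination by (relation "measure (\<lambda>(n, x, k). k)") auto

declare log_coeff.simps [simp del]

definition log_taylor :: "nat \<Rightarrow> nat \<Rightarrow> (nat \<times> nat \<Rightarrow> complex) \<Rightarrow> complex" where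
  "log_taylor n m x = of_real (ln (number_of_matchings n)) + (\<Sum>k<m. log_coeff n x k / of_nat (Suc k))"

lemma log_coeff_eq_power_sum:
  assumes "haf_line n x = Polynomial.smult c (\<Prod>r\<leftarrow>rs. [:1, -r:])"
  shows "log_coeff n x k = - (\<Sum>r\<leftarrow>rs. r ^ Suc k)"
proof (induction k rule: less_induct)
  case (less k)
  let ?g = "Polynomial.coeff (haf_line n x)" and ?p = "\<lambda>i. \<Sum>r\<leftarrow>rs. r ^ Suc i"
  have "of_nat (Suc k) * ?g (Suc k) = - (\<Sum>i<Suc k. ?g (k - i) * ?p i)"
    unfolding newton_identity[OF assms] by (simp only: lessThan_Suc_atMost)
  also have "\<dots> = - (\<Sum>i<k. ?g (k - i) * ?p i) - of_nat (number_of_matchings n) * ?p k"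
    by (simp add: coeff_haf_line_0 del: power_Suc)
  also have "(\<Sum>i<k. ?g (k - i) * ?p i) = - (\<Sum>i<k. ?g (k - i) * log_coeff n x i)"
    unfolding sum_negf[symmetric] using less by (intro sum.cong) (auto simp del: power_Suc)
  finally have "of_nat (Suc k) * ?g (Suc k) - (\<Sum>i<k. ?g (k - i) * log_coeff n x i)
     = of_nat (number_of_matchings n) * - ?p k" by (simp del: power_Suc of_nat_Suc)
  thus ?case using number_of_matchings_pos[of n] unfolding log_coeff.simps[of n x k]
    by (simp del: power_Suc of_nat_Suc)
qed

text \<open>The hypothesis says that all inverse roots \<open>r\<close> of the restricted hafnian have norm at most \<open>b\<close>.
  Then \<open>\<Sum>r\<leftarrow>rs. Ln (1 - t * r)\<close> is a continuous logarithm along the segment, and there are at most \<open>n\<close>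
  summands, each with truncation error at most \<open>b ^ Suc m / (1 - b)\<close>.\<close>

lemma ln_haf_taylor_error:
  assumes A: "A \<in> sym_near_ones n (1/2)" and b: "0 < b" "b < 1"
    and zero_free: "\<And>z. norm z * b < 1 \<Longrightarrow> poly (haf_line n (\<lambda>(i,j). A $$ (i,j))) z \<noteq> 0"
  shows "norm (ln_haf n A - log_taylor n m (\<lambda>(i,j). A $$ (i,j))) \<le> n * (b ^ Suc m / (1 - b))"
proof -
  define x where "x = (\<lambda>(i,j). A $$ (i,j))"
  define c :: complex where "c = of_nat (number_of_matchings n)"
  have c: "poly (haf_line n x) 0 = c" by (simp add: poly_0_coeff_0 coeff_haf_line_0 c_def)
  hence "poly (haf_line n x) 0 \<noteq> 0" using number_of_matchings_pos[of n] by (simp add: c_def)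
  then obtain rs where rs: "haf_line n x = Polynomial.smult c (\<Prod>r\<leftarrow>rs. [:1, -r:])" "length rs \<le> n"
    using inverse_root_factorization[of "haf_line n x"] degree_haf_line[of n x] c
    by (metis order_trans)
  have eval: "poly (haf_line n x) z = c * (\<Prod>r\<leftarrow>rs. 1 - z * r)" for z
    unfolding rs(1) by (simp, induction rs) (auto simp: algebra_simps)
  have small: "norm r \<le> b" if r: "r \<in> set rs" for r
  proof (rule ccontr)
    assume *: "\<not> norm r \<le> b"
    hence "r \<noteq> 0" using b by auto
    have "poly (haf_line n x) (1/r) = 0"
      unfolding eval using r \<open>r \<noteq> 0\<close> by (auto simp: prod_list_zero_iff image_iff intro!: bexI[of _ r])
    moreover have "norm (1/r) * b < 1" using * \<open>r \<noteq> 0\<close> b by (simp add: norm_divide field_simps)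
    ultimately show False using zero_free unfolding x_def by blast
  qed
  define h where "h = (\<lambda>t::real. of_real (ln (number_of_matchings n)) + (\<Sum>r\<leftarrow>rs. Ln (1 - of_real t * r)))"
  have disc: "1 - of_real t * r \<notin> \<real>\<^sub>\<le>\<^sub>0" if "t \<in> {0..1}" "r \<in> set rs" for t r
  proof -
    have "norm (of_real t * r) \<le> 1 * b"
      unfolding norm_mult using that small by (intro mult_mono) auto
    hence "Re (of_real t * r) < 1" using b(2) complex_Re_le_cmod[of "of_real t * r"] by linarith
    thus ?thesis by (simp add: complex_nonpos_Reals_iff)
  qed
  have "ln_haf n A = h 1"
  proof (rule ln_haf_eq_end_of_segment[OF A])
    have "continuous_on {0..1} (\<lambda>t. \<Sum>r\<leftarrow>rs. Ln (1 - of_real t * r))"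
      using disc by (induction rs) (auto intro!: continuous_intros)
    thus "continuous_on {0..1} h" unfolding h_def by (intro continuous_intros)
    have "(\<Sum>r\<leftarrow>rs. Ln (1 - of_real 0 * r)) = 0" by (induction rs) auto
    thus "h 0 = of_real (ln (number_of_matchings n))" by (simp add: h_def)
    fix t :: real assume t: "t \<in> {0..1}"
    have nz: "1 - of_real t * r \<noteq> 0" if "r \<in> set rs" for r
      using disc[OF t that] by auto
    have "exp (\<Sum>r\<leftarrow>rs. Ln (1 - of_real t * r)) = (\<Prod>r\<leftarrow>rs. 1 - of_real t * r)"
      using nz by (induction rs) (auto simp: exp_add)
    moreover have "exp (of_real (ln (number_of_matchings n))) = c"
      using number_of_matchings_pos[of n] by (simp add: c_def exp_of_real)
    ultimately have "exp (h t) = poly (haf_line n x) t" by (simp add: h_def exp_add eval)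
    thus "exp (h t) = matching_sum {..<2*n} (\<lambda>e. 1 + of_real t * (A $$ (Min e, Max e) - 1))"
      by (simp add: poly_haf_line x_def)
  qed
  moreover have "log_taylor n m x = of_real (ln (number_of_matchings n))
      + (\<Sum>k<m. - (\<Sum>r\<leftarrow>rs. r ^ Suc k) / of_nat (Suc k))"
    by (simp only: log_taylor_def log_coeff_eq_power_sum[OF rs(1)])
  ultimately have "norm (ln_haf n A - log_taylor n m x) \<le> length rs * (b ^ Suc m / (1 - b))"
    using sum_Ln_truncation_error[of rs b m] small b by (simp add: h_def del: power_Suc of_nat_Suc)
  also have "\<dots> \<le> n * (b ^ Suc m / (1 - b))"
    using rs(2) b by (intro mult_right_mono) auto
  finally show ?thesis by (simp add: x_def)
qed

section \<open>Polynomial functions of bounded degree\<close>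

text \<open>Degree bounds are tracked on functions, where sums and products are pointwise, and turned into
  formal polynomials once at the end. Multiplication by one variable at a time suffices to generate
  everything and is the only product that has to be mirrored formally.\<close>

inductive poly_fun :: "'v set \<Rightarrow> nat \<Rightarrow> (('v \<Rightarrow> 'a::comm_ring_1) \<Rightarrow> 'a) \<Rightarrow> bool" for V where
  const: "poly_fun V d (\<lambda>x. c)"
| add: "poly_fun V d f \<Longrightarrow> poly_fun V d g \<Longrightarrow> poly_fun V d (\<lambda>x. f x + g x)"
| var_mult: "v \<in> V \<Longrightarrow> poly_fun V d f \<Longrightarrow> poly_fun V (Suc d) (\<lambda>x. x v * f x)"

lemma poly_fun_mono: "poly_fun V d f \<Longrightarrow> d \<le> e \<Longrightarrow> poly_fun V e f"
proof (induction arbitrary: e rule: poly_fun.induct)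
  case (var_mult v d f)
  then obtain e' where "e = Suc e'" "d \<le> e'" by (cases e) auto
  thus ?case using var_mult by (auto intro: poly_fun.var_mult)
qed (auto intro: poly_fun.intros)

lemma poly_fun_cmult: "poly_fun V d f \<Longrightarrow> poly_fun V d (\<lambda>x. c * f x)"
proof (induction rule: poly_fun.induct)
  case (var_mult v d f)
  have "(\<lambda>x. c * (x v * f x)) = (\<lambda>x. x v * (c * f x))" by (simp add: mult.left_commute)
  thus ?case using var_mult by (auto intro: poly_fun.var_mult)
qed (auto simp: distrib_left intro: poly_fun.intros)

lemma poly_fun_mult: "poly_fun V d f \<Longrightarrow> poly_fun V e g \<Longrightarrow> poly_fun V (d + e) (\<lambda>x. f x * g x)"
proof (induction rule: poly_fun.induct)
  case (const d c)
  thus ?case by (intro poly_fun_mono[OF poly_fun_cmult]) auto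
next
  case (var_mult v d f)
  thus ?case using poly_fun.var_mult[OF var_mult(1) var_mult(3)] by (simp add: mult.assoc)
qed (auto simp: distrib_right intro: poly_fun.intros)

lemma poly_fun_diff:
  assumes "poly_fun V d f" "poly_fun V d g"
  shows "poly_fun V d (\<lambda>x. f x - g x)"
  using poly_fun.add[OF assms(1) poly_fun_cmult[OF assms(2), of "-1"]] by simp

lemma poly_fun_sum:
  "(\<And>i. i \<in> I \<Longrightarrow> poly_fun V d (f i)) \<Longrightarrow> poly_fun V d (\<lambda>x. \<Sum>i\<in>I. f i x)"
  by (induction I rule: infinite_finite_induct) (auto intro: poly_fun.intros)

lemma poly_fun_var: "v \<in> V \<Longrightarrow> poly_fun V 1 (\<lambda>x. x v)"
  using poly_fun.var_mult[of v V 0 "\<lambda>x. 1"] by (simp add: poly_fun.const)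

text \<open>The \<open>k\<close>-th coefficient in \<open>z\<close> has degree at most \<open>k\<close> in the variables. This is inherited by sums
  and products, and holds for the factors \<open>1 + z (x v - 1)\<close>.\<close>

definition graded_poly_fun :: "'v set \<Rightarrow> (('v \<Rightarrow> 'a::comm_ring_1) \<Rightarrow> 'a poly) \<Rightarrow> bool" where
  "graded_poly_fun V P \<longleftrightarrow> (\<forall>k. poly_fun V k (\<lambda>x. Polynomial.coeff (P x) k))"

lemma graded_poly_fun_mult:
  assumes "graded_poly_fun V P" "graded_poly_fun V Q"
  shows "graded_poly_fun V (\<lambda>x. P x * Q x)"
  unfolding graded_poly_fun_def coeff_mult
proof (intro allI poly_fun_sum)
  fix k i :: nat assume "i \<in> {..k}"
  thus "poly_fun V k (\<lambda>x. Polynomial.coeff (P x) i * Polynomial.coeff (Q x) (k - i))"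
    using poly_fun_mult[of V i "\<lambda>x. Polynomial.coeff (P x) i" "k - i" "\<lambda>x. Polynomial.coeff (Q x) (k - i)"]
      assms by (simp add: graded_poly_fun_def)
qed

lemma graded_poly_fun_prod:
  "(\<And>i. i \<in> I \<Longrightarrow> graded_poly_fun V (P i)) \<Longrightarrow> graded_poly_fun V (\<lambda>x. \<Prod>i\<in>I. P i x)"
proof (induction I rule: infinite_finite_induct)
  case (insert i I)
  thus ?case by (simp add: graded_poly_fun_mult)
qed (auto simp: graded_poly_fun_def poly_fun.const)

lemma graded_poly_fun_sum:
  "(\<And>i. i \<in> I \<Longrightarrow> graded_poly_fun V (P i)) \<Longrightarrow> graded_poly_fun V (\<lambda>x. \<Sum>i\<in>I. P i x)"
  by (auto simp: graded_poly_fun_def coeff_sum intro: poly_fun_sum)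

lemma graded_poly_fun_linear:
  assumes "v \<in> V"
  shows "graded_poly_fun V (\<lambda>x. [:1, x v - 1:])"
  unfolding graded_poly_fun_def
proof
  fix k
  consider "k = 0" | "k = 1" | j where "k = Suc (Suc j)" by (metis One_nat_def not0_implies_Suc)
  thus "poly_fun V k (\<lambda>x. Polynomial.coeff [:1, x v - 1:] k)"
    using poly_fun_diff[OF poly_fun_var[OF assms] poly_fun.const]
    by cases (auto intro: poly_fun.const)
qed

lemma graded_poly_fun_haf_line: "graded_poly_fun ({..<2*n} \<times> {..<2*n}) (haf_line n)"
  unfolding haf_line_def[abs_def] matching_sum_def
proof (intro graded_poly_fun_sum graded_poly_fun_prod graded_poly_fun_linear)
  fix M and e :: "nat set" assume "M \<in> pair_partitions {..<2*n}" "e \<in> M"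
  thus "(Min e, Max e) \<in> {..<2*n} \<times> {..<2*n}"
    using Min_Max_edge_less pair_partitions_edge by (metis SigmaI lessThan_iff)
qed

text \<open>The recursion is weighted homogeneous: a coefficient of index \<open>k - i\<close> meets a value of degree
  \<open>Suc i\<close>, which gives \<open>Suc k\<close> in total.\<close>

lemma poly_fun_log_coeff: "poly_fun ({..<2*n} \<times> {..<2*n}) (Suc k) (\<lambda>x. log_coeff n x k)"
proof (induction k rule: less_induct)
  case (less k)
  let ?V = "{..<2*n} \<times> {..<2*n}"
  have coeff: "poly_fun ?V j (\<lambda>x. Polynomial.coeff (haf_line n x) j)" for j
    using graded_poly_fun_haf_line by (auto simp: graded_poly_fun_def)
  have "poly_fun ?V (Suc k) (\<lambda>x. Polynomial.coeff (haf_line n x) (k - i) * log_coeff n x i)"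
    if "i < k" for i
    using poly_fun_mult[OF coeff less[OF that], of "k - i"] that by simp
  hence "poly_fun ?V (Suc k) (\<lambda>x. inverse (of_nat (number_of_matchings n)) *
     (of_nat (Suc k) * Polynomial.coeff (haf_line n x) (Suc k)
     - (\<Sum>i\<in>{..<k}. Polynomial.coeff (haf_line n x) (k - i) * log_coeff n x i)))"
    by (intro poly_fun_cmult poly_fun_diff poly_fun_sum coeff) auto
  thus ?case unfolding log_coeff.simps[of n _ k] by (simp only: divide_inverse mult.commute)
qed

lemma poly_fun_log_taylor: "poly_fun ({..<2*n} \<times> {..<2*n}) m (log_taylor n m)"
proof -
  have "poly_fun ({..<2*n} \<times> {..<2*n}) m (\<lambda>x. of_real (ln (number_of_matchings n)) +
     (\<Sum>k<m. inverse (of_nat (Suc k)) * log_coeff n x k))"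
    by (intro poly_fun.add poly_fun.const poly_fun_sum poly_fun_cmult poly_fun_mono[OF poly_fun_log_coeff]) auto
  thus ?thesis unfolding log_taylor_def[abs_def] by (simp only: divide_inverse mult.commute)
qed

subsection \<open>Representation by formal polynomials\<close>

definition monom_degree :: "('v \<Rightarrow>\<^sub>0 nat) \<Rightarrow> nat" where
  "monom_degree m = (\<Sum>v\<in>Poly_Mapping.keys m. Poly_Mapping.lookup m v)"

definition monom_eval :: "('v \<Rightarrow>\<^sub>0 nat) \<Rightarrow> ('v \<Rightarrow> 'a::comm_semiring_1) \<Rightarrow> 'a" where
  "monom_eval m x = (\<Prod>v\<in>Poly_Mapping.keys m. x v ^ Poly_Mapping.lookup m v)"

lemma monom_degree_times_var:
  "monom_degree (m + Poly_Mapping.single v 1) = Suc (monom_degree m)"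
proof -
  have *: "monom_degree m' = (\<Sum>w\<in>insert v (Poly_Mapping.keys m). Poly_Mapping.lookup m' w)"
    if "Poly_Mapping.keys m' \<subseteq> insert v (Poly_Mapping.keys m)" for m'
    unfolding monom_degree_def using that
    by (intro sum.mono_neutral_left) (auto simp: in_keys_iff)
  have "monom_degree (m + Poly_Mapping.single v 1) =
      (\<Sum>w\<in>insert v (Poly_Mapping.keys m). Poly_Mapping.lookup m w + (if w = v then 1 else 0))"
    using keys_add[of m "Poly_Mapping.single v 1"]
    by (subst *) (auto simp: lookup_add lookup_single when_def intro!: sum.cong)
  also have "\<dots> = monom_degree m + 1"
    by (subst *[of m]) (auto simp: sum.distrib)
  finally show ?thesis by simp
qed

lemma monom_eval_times_var:
  "monom_eval (m + Poly_Mapping.single v 1) x = x v * monom_eval m x"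
proof -
  have *: "monom_eval m' x = (\<Prod>w\<in>insert v (Poly_Mapping.keys m). x w ^ Poly_Mapping.lookup m' w)"
    if "Poly_Mapping.keys m' \<subseteq> insert v (Poly_Mapping.keys m)" for m'
    unfolding monom_eval_def using that
    by (intro prod.mono_neutral_left) (auto simp: in_keys_iff)
  have "monom_eval (m + Poly_Mapping.single v 1) x =
      (\<Prod>w\<in>insert v (Poly_Mapping.keys m). x w ^ Poly_Mapping.lookup m w * (if w = v then x v else 1))"
    using keys_add[of m "Poly_Mapping.single v 1"]
    by (subst *) (auto simp: lookup_add lookup_single when_def power_add intro!: prod.cong)
  also have "\<dots> = monom_eval m x * x v"
    by (subst *[of m]) (auto simp: prod.distrib)
  finally show ?thesis by (simp add: mult.commute)
qed

lemma mp_eval_superset: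
  assumes "finite S" "Poly_Mapping.keys p \<subseteq> S"
  shows "mp_eval p x = (\<Sum>m\<in>S. Poly_Mapping.lookup p m * monom_eval m x)"
  unfolding mp_eval_def monom_eval_def using assms
  by (intro sum.mono_neutral_left) (auto simp: in_keys_iff)

lemma mp_eval_add: "mp_eval (p + q) x = mp_eval p x + mp_eval q x"
proof -
  let ?S = "Poly_Mapping.keys p \<union> Poly_Mapping.keys q"
  have "mp_eval (p + q) x = (\<Sum>m\<in>?S. Poly_Mapping.lookup (p + q) m * monom_eval m x)"
    using keys_add[of p q] by (intro mp_eval_superset) auto
  also have "\<dots> = mp_eval p x + mp_eval q x"
    by (simp add: mp_eval_superset[of ?S] lookup_add distrib_right sum.distrib)
  finally show ?thesis .
qed

lemma mp_eval_single: "mp_eval (Poly_Mapping.single m c) x = c * monom_eval m x"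
  by (subst mp_eval_superset[of "{m}"]) auto

lemma mp_eval_sum: "mp_eval (\<Sum>i\<in>I. p i) x = (\<Sum>i\<in>I. mp_eval (p i) x)"
proof (induction I rule: infinite_finite_induct)
  case (insert i I)
  thus ?case by (simp add: mp_eval_add)
qed (simp_all add: mp_eval_def)

definition mp_within :: "'v set \<Rightarrow> nat \<Rightarrow> ('v, 'a::zero) mpolynomial \<Rightarrow> bool" where
  "mp_within V d p \<longleftrightarrow> (\<forall>m\<in>Poly_Mapping.keys p. Poly_Mapping.keys m \<subseteq> V \<and> monom_degree m \<le> d)"

lemma mp_within_bounds:
  assumes "mp_within V d p"
  shows "mp_vars p \<subseteq> V" "mp_degree p \<le> d"
  using assms unfolding mp_within_def mp_vars_def mp_degree_def monom_degree_def
  by (auto simp: Max_le_iff)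

lemma poly_fun_imp_mpolynomial:
  assumes "poly_fun V d f"
  shows "\<exists>p. mp_within V d p \<and> (\<forall>x. mp_eval p x = f x)"
  using assms
proof (induction rule: poly_fun.induct)
  case (const d c)
  have "mp_within V d (Poly_Mapping.single 0 c)"
    by (auto simp: mp_within_def monom_degree_def)
  moreover have "mp_eval (Poly_Mapping.single 0 c) x = c" for x
    by (simp add: mp_eval_single monom_eval_def)
  ultimately show ?case by blast
next
  case (add d f g)
  then obtain p q where "mp_within V d p" "mp_within V d q"
    and "\<forall>x. mp_eval p x = f x" "\<forall>x. mp_eval q x = g x" by blast
  moreover from this have "mp_within V d (p + q)"
    using keys_add[of p q] unfolding mp_within_def by blast
  ultimately show ?case by (metis mp_eval_add)
next
  case (var_mult v d f)
  then obtain p where p: "mp_within V d p" "\<And>x. mp_eval p x = f x" by blast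
  define s where "s = (\<lambda>m. Poly_Mapping.single (m + Poly_Mapping.single v 1) (Poly_Mapping.lookup p m))"
  define q where "q = (\<Sum>m\<in>Poly_Mapping.keys p. s m)"
  have "mp_eval q x = x v * f x" for x
  proof -
    have "mp_eval q x = (\<Sum>m\<in>Poly_Mapping.keys p. Poly_Mapping.lookup p m * (x v * monom_eval m x))"
      by (simp add: q_def s_def mp_eval_sum mp_eval_single monom_eval_times_var del: One_nat_def)
    also have "\<dots> = x v * mp_eval p x"
      by (simp add: mp_eval_superset[of "Poly_Mapping.keys p"] sum_distrib_left mult.left_commute)
    finally show ?thesis by (simp add: p)
  qed
  moreover have "mp_within V (Suc d) q"
    unfolding mp_within_def
  proof
    fix m' assume "m' \<in> Poly_Mapping.keys q"
    then obtain m where m: "m \<in> Poly_Mapping.keys p" "m' \<in> Poly_Mapping.keys (s m)"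
      unfolding q_def using keys_sum[of s] by blast
    hence m': "m' = m + Poly_Mapping.single v 1" by (auto simp: s_def split: if_splits)
    have "Poly_Mapping.keys m' \<subseteq> V"
      using keys_add[of m "Poly_Mapping.single v 1"] p(1) m(1) var_mult(1)
      by (auto simp: mp_within_def m')
    thus "Poly_Mapping.keys m' \<subseteq> V \<and> monom_degree m' \<le> Suc d"
      using p(1) m(1) unfolding m' monom_degree_times_var by (auto simp: mp_within_def)
  qed
  ultimately show ?case by blast
qed

section \<open>Choice of the degree\<close>

lemma sym_near_ones_mono: "r \<le> s \<Longrightarrow> sym_near_ones n r \<subseteq> sym_near_ones n s"
  by (fastforce simp: sym_near_ones_def)

text \<open>At the parameter \<open>z\<close> the entries are \<open>norm z\<close> times as far from \<open>1\<close> as those of \<open>A\<close>, so zeros are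
  excluded as long as that distance stays within \<open>1/2\<close>. For \<open>r < 1/2\<close> this covers a disc of
  radius larger than one.\<close>

lemma haf_line_zero_free:
  assumes "A \<in> sym_near_ones n r" "norm z * (2 * r) \<le> 1"
  shows "poly (haf_line n (\<lambda>(i,j). A $$ (i,j))) z \<noteq> 0"
  unfolding poly_haf_line
proof (rule matching_sum_nonzero)
  show "near_one_on {..<2*n} (\<lambda>e. 1 + z * ((case (Min e, Max e) of (i, j) \<Rightarrow> A $$ (i, j)) - 1))"
    unfolding near_one_on_def
  proof (intro allI impI)
    fix e :: "nat set" assume "e \<subseteq> {..<2*n}" "card e = 2"
    hence "norm (1 - A $$ (Min e, Max e)) \<le> r"
      using assms(1) Min_Max_edge_less by (auto simp: sym_near_ones_def)
    hence "norm z * norm (1 - A $$ (Min e, Max e)) \<le> norm z * r"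
      by (intro mult_left_mono) auto
    thus "norm (1 - (1 + z * ((case (Min e, Max e) of (i, j) \<Rightarrow> A $$ (i, j)) - 1))) \<le> 1/2"
      using assms(2) by (simp add: norm_mult norm_minus_commute)
  qed
qed auto

text \<open>For a \<open>2 \<times> 2\<close> matrix the hafnian is a single entry, and the line can be extended twice as far.
  This matters because \<open>ln n - ln \<epsilon>\<close> is arbitrarily small for \<open>n = 1\<close> and \<open>\<epsilon>\<close> near \<open>1\<close>, so that a
  constant has to do as the approximating polynomial.\<close>

lemma haf_line_zero_free_order_two:
  assumes "A \<in> sym_near_ones 1 r" "norm z * r < 1"
  shows "poly (haf_line 1 (\<lambda>(i,j). A $$ (i,j))) z \<noteq> 0"
proof -
  have S: "{..<2 * 1::nat} = {0, 1}" by auto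
  have "poly (haf_line 1 (\<lambda>(i,j). A $$ (i,j))) z = 1 + z * (A $$ (0, 1) - 1)"
    unfolding poly_haf_line S by (subst matching_sum_row[of _ 0]) (auto simp: matching_sum_empty)
  moreover have "norm (z * (A $$ (0, 1) - 1)) \<le> norm z * r"
    using assms(1) unfolding norm_mult
    by (intro mult_left_mono) (auto simp: sym_near_ones_def norm_minus_commute)
  ultimately show ?thesis using assms(2)
    by (metis add_eq_0_iff norm_minus_cancel norm_one not_le)
qed

text \<open>Taking logarithms, the error bound becomes linear in \<open>m\<close>. The lower bound \<open>x0\<close> is needed to absorb
  the additive constants, including the one from rounding up, into a multiple of \<open>ln n - ln \<epsilon>\<close>.\<close>

lemma truncation_degree:
  fixes b X x0 \<epsilon> :: real and n :: nat
  assumes b: "0 < b" "b < 1" and x0: "0 < x0" "x0 \<le> ln n - ln \<epsilon>" and n: "n \<ge> 1" and \<epsilon>: "\<epsilon> > 0"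
  defines "c \<equiv> - ln (1 - b)" and "l \<equiv> - ln b"
  shows "\<exists>m. n * (b ^ Suc m / (1 - b)) \<le> \<epsilon> \<and> m \<le> (1 / l + (c / l + 1) / x0) * (ln n - ln \<epsilon>)"
proof -
  define X where "X = ln n - ln \<epsilon>"
  have l: "l > 0" and c: "c > 0" using b by (auto simp: l_def c_def)
  define m where "m = nat \<lceil>(X + c) / l\<rceil>"
  have pos: "(X + c) / l \<ge> 0" using x0 l c by (simp add: X_def)
  have m: "(X + c) / l \<le> m" "m \<le> (X + c) / l + 1"
    using pos unfolding m_def by linarith+
  have "X + c \<le> Suc m * l" using m(1) l by (simp add: field_simps)
  hence "ln n + Suc m * ln b - ln (1 - b) \<le> ln \<epsilon>"
    by (simp add: X_def l_def c_def)
  hence "exp (ln n + Suc m * ln b - ln (1 - b)) \<le> exp (ln \<epsilon>)" by simp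
  also have "exp (ln n + Suc m * ln b - ln (1 - b)) = n * (b ^ Suc m / (1 - b))"
    using b n by (simp add: exp_add exp_diff exp_of_nat_mult del: of_nat_Suc power_Suc)
  finally have "n * (b ^ Suc m / (1 - b)) \<le> \<epsilon>" using \<epsilon> by simp
  moreover have "m \<le> (1 / l + (c / l + 1) / x0) * X"
  proof -
    have "(c / l + 1) * 1 \<le> (c / l + 1) * (X / x0)"
      using x0 l c by (intro mult_left_mono) (auto simp: X_def)
    thus ?thesis using m(2) by (simp add: add_divide_distrib algebra_simps)
  qed
  ultimately show ?thesis unfolding X_def by blast
qed

theorem theorem2p5:
  fixes \<eta> :: real
  assumes "0 \<le> \<eta>" and "\<eta> < 1/2"
  shows "\<exists>\<gamma>::real. \<gamma> > 0 \<and>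
    (\<forall>n::nat. \<forall>\<epsilon>::real. n \<ge> 1 \<longrightarrow> 0 < \<epsilon> \<longrightarrow> \<epsilon> < 1 \<longrightarrow>
      (\<exists>p :: (nat \<times> nat, complex) mpolynomial.
        mp_vars p \<subseteq> {..<2 * n} \<times> {..<2 * n} \<and>
        real (mp_degree p) \<le> \<gamma> * (ln (real n) - ln \<epsilon>) \<and>
        (\<forall>A\<in>sym_near_ones n \<eta>. norm (ln_haf n A - mp_eval p (\<lambda>(i, j). A $$ (i, j))) \<le> \<epsilon>)))"
proof -
  (* The value 1/4 only serves to keep r, and with it b and q, away from zero. *)
  define r where "r = max \<eta> (1/4)"
  define b where "b = 2 * r"
  (* The error of the constant approximation for n = 1; it is below 1 since r < 1/2. *)
  define q where "q = r / (1 - r)"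
  have r: "0 < r" "r < 1/2" "\<eta> \<le> r" using assms by (auto simp: r_def)
  have b: "0 < b" "b < 1" using r by (auto simp: b_def)
  have q: "0 < q" "q < 1" using r by (auto simp: q_def)
  (* A lower bound for ln n - ln \<epsilon> whenever n > 1 or \<epsilon> < q. *)
  define x0 where "x0 = min (ln 2) (- ln q)"
  have x0: "x0 > 0" using q by (simp add: x0_def)
  define \<gamma> where "\<gamma> = 1 / (- ln b) + ((- ln (1 - b)) / (- ln b) + 1) / x0"
  have lb: "- ln b > 0" "- ln (1 - b) > 0" using b by auto
  have \<gamma>: "\<gamma> > 0"
    unfolding \<gamma>_def by (intro add_pos_pos divide_pos_pos x0 lb) simp_all
  have sub: "sym_near_ones n \<eta> \<subseteq> sym_near_ones n r" "sym_near_ones n r \<subseteq> sym_near_ones n (1/2)" for n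
    using r by (auto intro!: sym_near_ones_mono)
  have truncation: "\<exists>m. real m \<le> \<gamma> * (ln n - ln \<epsilon>) \<and>
      (\<forall>A\<in>sym_near_ones n \<eta>. norm (ln_haf n A - log_taylor n m (\<lambda>(i, j). A $$ (i, j))) \<le> \<epsilon>)"
    if n: "n \<ge> 1" and \<epsilon>: "0 < \<epsilon>" "\<epsilon> < 1" for n :: nat and \<epsilon> :: real
  proof (cases "n = 1 \<and> q \<le> \<epsilon>")
    case True
    have "norm (ln_haf n A - log_taylor n 0 (\<lambda>(i, j). A $$ (i, j))) \<le> \<epsilon>"
      if A: "A \<in> sym_near_ones n \<eta>" for A
    proof -
      have "norm (ln_haf n A - log_taylor n 0 (\<lambda>(i, j). A $$ (i, j))) \<le> n * (r ^ Suc 0 / (1 - r))"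
        proof (rule ln_haf_taylor_error)
        show "A \<in> sym_near_ones n (1/2)" using A sub by blast
        fix z :: complex assume "norm z * r < 1"
        thus "poly (haf_line n (\<lambda>(i,j). A $$ (i,j))) z \<noteq> 0"
          using haf_line_zero_free_order_two[of A r z] A sub[of n] True by auto
      qed (use r in auto)
      thus ?thesis using True by (simp add: q_def)
    qed
    moreover have "real 0 \<le> \<gamma> * (ln n - ln \<epsilon>)"
      using True \<epsilon> \<gamma> by (simp add: mult_nonneg_nonpos)
    ultimately show ?thesis by blast
  next
    case False
    have "x0 \<le> ln n - ln \<epsilon>"
    proof (cases "n = 1")
      case True
      hence "ln \<epsilon> \<le> ln q" using False \<epsilon> q by simp
      thus ?thesis using True by (simp add: x0_def)
    next
      case False
      hence "ln 2 \<le> ln n" using n by simp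
      moreover have "ln \<epsilon> \<le> 0" using \<epsilon> by simp
      ultimately show ?thesis by (simp add: x0_def)
    qed
    from truncation_degree[OF b x0 this n \<epsilon>(1)] obtain m where
      m: "n * (b ^ Suc m / (1 - b)) \<le> \<epsilon>" "m \<le> \<gamma> * (ln n - ln \<epsilon>)"
      unfolding \<gamma>_def by blast
    have "norm (ln_haf n A - log_taylor n m (\<lambda>(i, j). A $$ (i, j))) \<le> \<epsilon>"
      if A: "A \<in> sym_near_ones n \<eta>" for A
    proof (rule order_trans[OF ln_haf_taylor_error m(1)])
      show "A \<in> sym_near_ones n (1/2)" using A sub by blast
      fix z :: complex assume "norm z * b < 1"
      thus "poly (haf_line n (\<lambda>(i,j). A $$ (i,j))) z \<noteq> 0"
        using A sub by (intro haf_line_zero_free[of A n r]) (auto simp: b_def)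
    qed (use b in auto)
    thus ?thesis using m(2) by blast
  qed
  have "\<exists>p :: (nat \<times> nat, complex) mpolynomial.
        mp_vars p \<subseteq> {..<2 * n} \<times> {..<2 * n} \<and>
        real (mp_degree p) \<le> \<gamma> * (ln (real n) - ln \<epsilon>) \<and>
        (\<forall>A\<in>sym_near_ones n \<eta>. norm (ln_haf n A - mp_eval p (\<lambda>(i, j). A $$ (i, j))) \<le> \<epsilon>)"
    if bounds: "n \<ge> 1" "0 < \<epsilon>" "\<epsilon> < 1" for n :: nat and \<epsilon> :: real
  proof -
    obtain m where m: "real m \<le> \<gamma> * (ln n - ln \<epsilon>)"
      "\<forall>A\<in>sym_near_ones n \<eta>. norm (ln_haf n A - log_taylor n m (\<lambda>(i, j). A $$ (i, j))) \<le> \<epsilon>"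
      using truncation[OF bounds] by blast
    obtain p where p: "mp_within ({..<2*n} \<times> {..<2*n}) m p" "\<forall>x. mp_eval p x = log_taylor n m x"
      using poly_fun_imp_mpolynomial[OF poly_fun_log_taylor] by blast
    show ?thesis
      using mp_within_bounds[OF p(1)] m p(2) by (intro exI[of _ p]) auto
  qed
  thus ?thesis using \<gamma> by blast
qed

end
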